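(* Let $n$, $k\ge1$, $l\ge1$ be integers, let $1\le s_{1,1}<\ldots<s_{1,k}<\frac n2$ and $1\le s_{2,1}<\ldots<s_{2,l}<\frac n2$ be integers, and let $C_1=C_n(s_{1,1},\ldots,s_{1,k})$ and $C_2=C_n(s_{2,1},\ldots,s_{2,l})$ be circulant graphs. Let $G$ be the cobordism of $C_1$ and $C_2$, and let $\widetilde{G}$ be the cone over $G$. Then $Jac(\widetilde{G})$ is isomorphic to the cokernel of the linear operator $\mathcal{A}^n-I$, where $\mathcal{A}$ is the companion matrix of the bimonic Laurent polynomial $$\Big(2k+2-\sum_{r=1}^{k}(z^{s_{1,r}}+z^{-s_{1,r}})\Big)\Big(2l+2-\sum_{r=1}^{l}(z^{s_{2,r}}+z^{-s_{2,r}})\Big)-1$$ and $I$ is the identity matrix of the same size as $\mathcal{A}$.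
   Context: The circulant graph $C_n(s_1,\ldots,s_k)$ has vertices $0,\ldots,n-1$, with vertex $i$ adjacent to $i\pm s_1,\ldots,i\pm s_k \pmod n$. The cobordism of two circulant graphs $C_1,C_2$ on the same vertex labels $0,\ldots,n-1$ is the graph obtained from the disjoint union of $C_1$ and $C_2$ by joining vertex $i$ of $C_1$ to vertex $i$ of $C_2$ by an edge, for each $i$. The cone over a graph $G$ is obtained by adding a new vertex joined by a single edge to every vertex of $G$. For a connected graph $H$ on $m$ vertices with Laplacian $L(H)=D(H)-A(H)$, the Jacobian $Jac(H)$ is the torsion subgroup of $\mathbb{Z}^m/\mathrm{im}\,L(H)$. For a bimonic integer Laurent polynomial $P(z)=z^{p}+a_1z^{p+1}+\ldots+a_{s-1}z^{p+s-1}+z^{p+s}$ ($s>0$), its companion matrix is the $s\times s$ integer matrix with first $s-1$ rows $(0\mid I_{s-1})$ and last row $(-1,-a_1,\ldots,-a_{s-1})$. For a square integer matrix $M$ of size $s$, $\mathrm{coker}\,M=\mathbb{Z}^s/\mathrm{im}\,M$. *)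

theory Defs
  imports
    "HOL-Algebra.Product_Groups"
    "HOL-Number_Theory.Cong"
    "HOL-Library.Poly_Mapping"
    "Jordan_Normal_Form.Matrix"
    "Graph_Theory.Graph_Theory"
begin

section \<open>Graphs\<close>

text \<open>
  As in \<open>Graph_Theory\<close>, a finite simple graph is a symmetric loop-free digraph
  (locale \<^locale>\<open>pair_graph\<close>), each edge being a pair of opposite arcs.
\<close>

text \<open>The jumps are \<open>s 1, \<dots>, s k\<close>; other values of \<open>s\<close> are irrelevant.\<close>

definition circulant_graph :: "nat \<Rightarrow> nat \<Rightarrow> (nat \<Rightarrow> nat) \<Rightarrow> nat pair_pre_digraph" where
  "circulant_graph n k s =
    \<lparr>pverts = {..<n},
     parcs = {(i, j). i < n \<and> j < n \<and>
       (\<exists>r\<in>{1..k}. [int j = int i + int (s r)] (mod int n) \<or>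
                    [int j = int i - int (s r)] (mod int n))}\<rparr>"

definition cobordism :: "'a pair_pre_digraph \<Rightarrow> 'a pair_pre_digraph \<Rightarrow> ('a + 'a) pair_pre_digraph" where
  "cobordism G H =
    \<lparr>pverts = pverts G <+> pverts H,
     parcs = {(Inl u, Inl v) |u v. (u, v) \<in> parcs G}
           \<union> {(Inr u, Inr v) |u v. (u, v) \<in> parcs H}
           \<union> {(Inl v, Inr v) |v. v \<in> pverts G \<inter> pverts H}
           \<union> {(Inr v, Inl v) |v. v \<in> pverts G \<inter> pverts H}\<rparr>"

definition cone :: "'a pair_pre_digraph \<Rightarrow> 'a option pair_pre_digraph" where
  "cone G =
    \<lparr>pverts = insert None (Some ` pverts G),
     parcs = {(Some u, Some v) |u v. (u, v) \<in> parcs G}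
           \<union> {(None, Some v) |v. v \<in> pverts G}
           \<union> {(Some v, None) |v. v \<in> pverts G}\<rparr>"

lemma pair_graph_circulant:
  assumes "\<And>r. r \<in> {1..k} \<Longrightarrow> 1 \<le> s r \<and> s r < n"
  shows "pair_graph (circulant_graph n k s)"
proof
  show "finite (parcs (circulant_graph n k s))"
    by (rule finite_subset[of _ "{..<n} \<times> {..<n}"]) (auto simp: circulant_graph_def)
  have "[int i = int j + d] (mod int n) \<longleftrightarrow> [int j = int i - d] (mod int n)" for i j d
    by (simp add: cong_iff_dvd_diff dvd_diff_commute[of _ "int i"] algebra_simps)
  then show "symmetric (with_proj (circulant_graph n k s))"
    unfolding symmetric_def with_proj_simps circulant_graph_def
    by (auto intro!: symI dest: cong_sym)
next
  fix e assume "e \<in> parcs (circulant_graph n k s)"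
  then obtain i r where e: "fst e = i" "r \<in> {1..k}"
    and "[int (snd e) = int i + int (s r)] (mod int n) \<or> [int (snd e) = int i - int (s r)] (mod int n)"
    by (auto simp: circulant_graph_def)
  then have "snd e = i \<Longrightarrow> int n dvd int (s r)"
    by (auto simp: cong_iff_dvd_diff)
  moreover have "\<not> int n dvd int (s r)"
    using assms[OF e(2)] by (auto simp: dvd_imp_le dest!: dvd_imp_le)
  ultimately show "fst e \<noteq> snd e" using e by auto
qed (auto simp: circulant_graph_def)

lemma pair_graph_cobordism:
  assumes "pair_graph G" "pair_graph H"
  shows "pair_graph (cobordism G H)"
proof -
  interpret G: pair_graph G by fact
  interpret H: pair_graph H by fact
  have *: "pverts (cobordism G H) = pverts G <+> pverts H" by (simp add: cobordism_def)
  have wf: "parcs (cobordism G H) \<subseteq> pverts (cobordism G H) \<times> pverts (cobordism G H)"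
    by (auto simp: cobordism_def dest: G.wellformed' H.wellformed')
  have fin: "finite (pverts (cobordism G H))"
    by (simp add: * G.pair_finite_verts H.pair_finite_verts)
  show ?thesis
  proof
    show "finite (parcs (cobordism G H))"
      using wf fin by (meson finite_SigmaI finite_subset)
    show "symmetric (with_proj (cobordism G H))"
      unfolding symmetric_def with_proj_simps
      by (rule symI) (auto simp: cobordism_def dest: G.arcs_symmetric H.arcs_symmetric)
  next
    fix e assume "e \<in> parcs (cobordism G H)"
    then show "fst e \<noteq> snd e"
      by (auto simp: cobordism_def dest: G.no_loops' H.no_loops')
  qed (use wf fin in auto)
qed

lemma pair_graph_cone:
  assumes "pair_graph G"
  shows "pair_graph (cone G)"
proof -
  interpret G: pair_graph G by fact
  have wf: "parcs (cone G) \<subseteq> pverts (cone G) \<times> pverts (cone G)"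
    by (auto simp: cone_def dest: G.wellformed')
  have fin: "finite (pverts (cone G))"
    by (simp add: cone_def G.pair_finite_verts)
  show ?thesis
  proof
    show "finite (parcs (cone G))"
      using wf fin by (meson finite_SigmaI finite_subset)
    show "symmetric (with_proj (cone G))"
      unfolding symmetric_def with_proj_simps
      by (rule symI) (auto simp: cone_def dest: G.arcs_symmetric)
  next
    fix e assume "e \<in> parcs (cone G)"
    then show "fst e \<noteq> snd e"
      by (auto simp: cone_def dest: G.no_loops')
  qed (use wf fin in auto)
qed

lemma connected_cone:
  assumes "pair_graph G"
  shows "connected (with_proj (cone G))"
proof -
  let ?V = "pverts (cone G)" and ?R = "(parcs (cone G))\<^sup>s"
  have down: "(u, None) \<in> rtrancl_on ?V ?R" and up: "(None, u) \<in> rtrancl_on ?V ?R" if "u \<in> ?V" for u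
    using that by (auto simp: cone_def symcl_def
      intro!: rtrancl_on_into_rtrancl_on[OF rtrancl_on_refl])
  show ?thesis
    unfolding connected_conv with_proj_simps
    using rtrancl_on_trans[OF down up] by (auto simp: cone_def)
qed


section \<open>Cokernels of integer matrices and the Jacobian\<close>

abbreviation int_lattice :: "'i set \<Rightarrow> ('i \<Rightarrow> int) monoid" where
  "int_lattice I \<equiv> product_group I (\<lambda>_. integer_group)"

text \<open>A matrix with rows and columns indexed by \<open>I\<close>, as an operator on column vectors.\<close>

definition mat_apply :: "'i set \<Rightarrow> ('i \<Rightarrow> 'i \<Rightarrow> int) \<Rightarrow> ('i \<Rightarrow> int) \<Rightarrow> ('i \<Rightarrow> int)" where
  "mat_apply I M x = (\<lambda>i\<in>I. \<Sum>j\<in>I. M i j * x j)"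

definition coker :: "'i set \<Rightarrow> ('i \<Rightarrow> 'i \<Rightarrow> int) \<Rightarrow> ('i \<Rightarrow> int) set monoid" where
  "coker I M = int_lattice I Mod (mat_apply I M ` carrier (int_lattice I))"

definition coker_mat :: "int mat \<Rightarrow> (nat \<Rightarrow> int) set monoid" where
  "coker_mat M = coker {..<dim_row M} (\<lambda>i j. M $$ (i, j))"

lemma normal_mat_apply_image:
  "mat_apply I M ` carrier (int_lattice I) \<lhd> int_lattice I"
proof -
  interpret G: group "int_lattice I" by simp
  interpret L: comm_group "int_lattice I"
    by (rule G.group_comm_groupI) (auto simp: add.commute)
  have "mat_apply I M \<in> hom (int_lattice I) (int_lattice I)"
    by (rule homI) (auto simp: mat_apply_def fun_eq_iff restrict_def distrib_left sum.distrib)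
  then interpret group_hom "int_lattice I" "int_lattice I" "mat_apply I M"
    by unfold_locales
  show ?thesis
    using img_is_subgroup by (rule L.subgroup_imp_normal)
qed

definition torsion_subgroup :: "('a, 'b) monoid_scheme \<Rightarrow> ('a, 'b) monoid_scheme" where
  "torsion_subgroup G = G\<lparr>carrier := {x \<in> carrier G. \<exists>m::nat. m > 0 \<and> x [^]\<^bsub>G\<^esub> m = \<one>\<^bsub>G\<^esub>}\<rparr>"

definition adjacency :: "'a pair_pre_digraph \<Rightarrow> 'a \<Rightarrow> 'a \<Rightarrow> int" where
  "adjacency G u v = (if (u, v) \<in> parcs G then 1 else 0)"

definition laplacian :: "'a pair_pre_digraph \<Rightarrow> 'a \<Rightarrow> 'a \<Rightarrow> int" where
  "laplacian G u v = (if u = v then int (out_degree (with_proj G) u) else 0) - adjacency G u v"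

definition jacobian :: "'a pair_pre_digraph \<Rightarrow> ('a \<Rightarrow> int) set monoid" where
  "jacobian G = torsion_subgroup (coker (pverts G) (laplacian G))"


section \<open>Laurent polynomials and companion matrices\<close>

text \<open>
  Finitely supported functions on \<open>\<int>\<close> with convolution form the ring
  $\mathbb{Z}[z, z^{-1}]$; the coefficient of $z^i$ in \<open>P\<close> is \<open>Poly_Mapping.lookup P i\<close>.
\<close>

type_synonym laurent = "int \<Rightarrow>\<^sub>0 int"

abbreviation zpow :: "int \<Rightarrow> laurent" where
  "zpow i \<equiv> Poly_Mapping.single i 1"

definition low_exp :: "laurent \<Rightarrow> int" where
  "low_exp P = Min (Poly_Mapping.keys P)"

definition high_exp :: "laurent \<Rightarrow> int" where
  "high_exp P = Max (Poly_Mapping.keys P)"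

definition bimonic :: "laurent \<Rightarrow> bool" where
  "bimonic P \<longleftrightarrow> low_exp P < high_exp P \<and> Poly_Mapping.lookup P (low_exp P) = 1 \<and> Poly_Mapping.lookup P (high_exp P) = 1"

text \<open>
  For bimonic \<open>P\<close> the coefficient at \<open>low_exp P\<close> is 1, so the last row is
  $(-1, -a_1, \dots, -a_{s-1})$.
\<close>

definition companion :: "laurent \<Rightarrow> int mat" where
  "companion P = (let s = nat (high_exp P - low_exp P) in
     mat s s (\<lambda>(i, j). if i = s - 1 then - Poly_Mapping.lookup P (low_exp P + int j)
                       else if j = i + 1 then 1 else 0))"

lemma lookup_single_times:
  fixes P :: laurent
  shows "Poly_Mapping.lookup (Poly_Mapping.single a c * P) i = c * Poly_Mapping.lookup P (i - a)"
proof -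
  have "Poly_Mapping.lookup (Poly_Mapping.single a c * P) i
      = Sum_any (\<lambda>l. (c when a = l) * Sum_any (\<lambda>q. Poly_Mapping.lookup P q when q = i - l))"
    unfolding lookup_mult lookup_single
    by (intro Sum_any.cong arg_cong2[where f = "(*)"]) (auto simp: when_def)
  also have "\<dots> = Sum_any (\<lambda>l. c * Poly_Mapping.lookup P (i - l) when l = a)"
    by (intro Sum_any.cong) (simp only: Sum_any_when_equal, simp add: when_def)
  finally show ?thesis by simp
qed

lemma lookup_factor:
  "Poly_Mapping.lookup (of_nat c - (\<Sum>r=1..k. zpow (int (s r)) + zpow (- int (s r)))) i =
     (if i = 0 then int c else 0) -
     (\<Sum>r=1..k. (if i = int (s r) then 1 else 0) + (if i = - int (s r) then 1 else 0))"
  by (auto simp: lookup_minus lookup_sum lookup_add lookup_single when_def lookup_of_nat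
      simp del: of_nat_add of_nat_mult intro!: sum.cong)

lemma bimonic_product_poly:
  fixes P :: laurent
  assumes s: "strict_mono_on {1..k} s" "1 \<le> k" "1 \<le> s 1"
    and t: "strict_mono_on {1..l} t" "1 \<le> l" "1 \<le> t 1"
    and P: "P = (of_nat (2 * k + 2) - (\<Sum>r=1..k. zpow (int (s r)) + zpow (- int (s r)))) *
                (of_nat (2 * l + 2) - (\<Sum>r=1..l. zpow (int (t r)) + zpow (- int (t r)))) - 1"
  shows "bimonic P" and "low_exp P = - int (s k + t l)" and "high_exp P = int (s k + t l)"
proof -
  let ?B = "of_nat (2 * l + 2) - (\<Sum>r=1..l. zpow (int (t r)) + zpow (- int (t r)))"
  define B where "B = Poly_Mapping.lookup ?B"
  have mono: "1 \<le> u r \<and> u r \<le> u m" "u r = u m \<longleftrightarrow> r = m"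
    if "strict_mono_on {1..m} u" "1 \<le> m" "1 \<le> u 1" "r \<in> {1..m}" for u :: "nat \<Rightarrow> nat" and r m
  proof -
    have "u 1 \<le> u r" "u r \<le> u m"
      using that strict_mono_on_leD[OF that(1)] by auto
    then show "1 \<le> u r \<and> u r \<le> u m" using that by simp
    show "u r = u m \<longleftrightarrow> r = m"
      using strict_mono_on_eqD[OF that(1)] that by auto
  qed
  have B0: "B i = 0" if "\<bar>i\<bar> > int (t l)" for i
    using that mono[OF t] unfolding B_def lookup_factor by (fastforce intro!: sum.neutral)
  have B1: "B (int (t l)) = -1" "B (- int (t l)) = -1"
  proof -
    have *: "(\<Sum>r=1..l. (if int (t l) = int (t r) then 1 else 0) + (if int (t l) = - int (t r) then 1 else 0))
        = (\<Sum>r=1..l. if r = l then 1 else (0::int))"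
      using mono[OF t] by (intro sum.cong) force+
    have **: "(\<Sum>r=1..l. (if - int (t l) = int (t r) then 1 else 0) + (if - int (t l) = - int (t r) then 1 else 0))
        = (\<Sum>r=1..l. if r = l then 1 else (0::int))"
      using mono[OF t] by (intro sum.cong) force+
    show "B (int (t l)) = -1" "B (- int (t l)) = -1"
      unfolding B_def lookup_factor * ** using t mono[OF t, of l] by auto
  qed
  have L: "Poly_Mapping.lookup P i = int (2 * k + 2) * B i - (\<Sum>r=1..k. B (i - int (s r)) + B (i + int (s r)))
      - (if i = 0 then 1 else 0)" for i
  proof -
    have "of_nat (2 * k + 2) = (Poly_Mapping.single 0 (int (2 * k + 2)) :: laurent)"
      by (metis single_of_nat)
    then show ?thesis
      by (simp add: P B_def left_diff_distrib distrib_right sum_distrib_right lookup_minus lookup_add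
          lookup_sum lookup_single_times lookup_one when_def del: of_nat_add of_nat_mult)
  qed
  have P0: "Poly_Mapping.lookup P i = 0" if "\<bar>i\<bar> > int (s k + t l)" for i
  proof -
    have "B (i - int (s r)) + B (i + int (s r)) = 0" if "r \<in> {1..k}" for r
    proof -
      have "\<bar>i - int (s r)\<bar> > int (t l)" "\<bar>i + int (s r)\<bar> > int (t l)"
        using mono(1)[OF s that] \<open>\<bar>i\<bar> > _\<close> by auto
      then show ?thesis by (simp add: B0)
    qed
    then show ?thesis using that by (simp add: L B0)
  qed
  let ?d = "int (s k + t l)"
  have "(\<Sum>r=1..k. B (?d - int (s r)) + B (?d + int (s r))) = (\<Sum>r=1..k. if r = k then -1 else 0)"
  proof (rule sum.cong)
    fix r assume r: "r \<in> {1..k}"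
    have "r \<noteq> k \<Longrightarrow> s r < s k" using mono[OF s r] by auto
    then show "B (?d - int (s r)) + B (?d + int (s r)) = (if r = k then -1 else 0)"
      using mono(1)[OF s r] by (auto simp: B0 B1)
  qed simp
  then have hi: "Poly_Mapping.lookup P ?d = 1"
    using s mono(1)[OF s, of k] by (simp add: L B0)
  have "(\<Sum>r=1..k. B (- ?d - int (s r)) + B (- ?d + int (s r))) = (\<Sum>r=1..k. if r = k then -1 else 0)"
  proof (rule sum.cong)
    fix r assume r: "r \<in> {1..k}"
    have "r \<noteq> k \<Longrightarrow> s r < s k" using mono[OF s r] by auto
    then show "B (- ?d - int (s r)) + B (- ?d + int (s r)) = (if r = k then -1 else 0)"
      using mono(1)[OF s r] by (auto simp: B0 B1)
  qed simp
  then have lo: "Poly_Mapping.lookup P (- ?d) = 1"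
    using s mono(1)[OF s, of k] by (simp add: L B0)
  have keys: "Poly_Mapping.keys P \<subseteq> {- ?d..?d}"
    using P0 by (force simp: in_keys_iff)
  show lo': "low_exp P = - int (s k + t l)"
    unfolding low_exp_def using keys lo by (intro Min_eqI) (auto simp: in_keys_iff)
  show hi': "high_exp P = int (s k + t l)"
    unfolding high_exp_def using keys hi by (intro Max_eqI) (auto simp: in_keys_iff)
  show "bimonic P"
    unfolding bimonic_def lo' hi' using lo hi s mono(1)[OF s, of k] by auto
qed

end

theory Submission
  imports Defs "Jordan_Normal_Form.Determinant"
begin

text \<open>
  In a connected graph with a vertex \<open>r\<close>, the torsion of the cokernel of the Laplacian is the
  cokernel of the Laplacian with row and column \<open>r\<close> deleted. For the cone over the cobordism and its
  apex this reduced matrix is \<open>(x, y) \<mapsto> (F\<^sub>1 x - y, F\<^sub>2 y - x)\<close>, where \<open>x, y\<close> are regarded as elements of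
  $\mathbb{Z}[z]/(z^n - 1)$ and \<open>F\<^sub>1, F\<^sub>2\<close> are the two factors of the Laurent polynomial \<open>P = F\<^sub>1 F\<^sub>2 - 1\<close>.
  Eliminating \<open>y = F\<^sub>1 x\<close> identifies its cokernel with the additive group of
  $\mathbb{Z}[z, z^{-1}]/(P, z^n - 1)$. On the other hand $\mathbb{Z}[z, z^{-1}]/(P)$ is free on the
  Horner polynomials of \<open>P\<close>, and multiplication by \<open>z\<close> acts on this basis as the companion matrix, so the
  same quotient is the cokernel of \<open>A\<^sup>n - I\<close>.
\<close>

section \<open>Cokernels\<close>

text \<open>Composed with the projection to \<open>H Mod K\<close>, the map \<open>f\<close> has
  kernel \<open>N\<close>, and the last hypothesis says that every coset of \<open>K\<close> meets
  the image of \<open>f\<close>. The first isomorphism theorem applies.\<close>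

lemma Mod_iso_Mod:
  assumes G: "group G" and K: "K \<lhd> H" and f: "f \<in> hom G H"
    and N: "{x \<in> carrier G. f x \<in> K} = N"
    and onto: "\<And>y. y \<in> carrier H \<Longrightarrow> \<exists>x\<in>carrier G. y \<otimes>\<^bsub>H\<^esub> inv\<^bsub>H\<^esub> f x \<in> K"
  shows "G Mod N \<cong> H Mod K"
proof -
  interpret K: normal K H by fact
  let ?h = "\<lambda>x. K #>\<^bsub>H\<^esub> f x"
  have fc: "f x \<in> carrier H" if "x \<in> carrier G" for x
    using f that by (auto simp: hom_def)
  have "?h \<in> hom G (H Mod K)"
    using hom_compose[OF f K.r_coset_hom_Mod] by (simp add: comp_def)
  then interpret h: group_hom G "H Mod K" ?h
    by (simp add: group_hom_def group_hom_axioms_def G K.factorgroup_is_group)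
  have "kernel G (H Mod K) ?h = N"
    using fc K.rcos_const[OF K.is_group] K.coset_join1[OF _ _ K.is_subgroup]
    by (auto simp: kernel_def N[symmetric])
  moreover have "?h ` carrier G = carrier (H Mod K)"
  proof
    show "carrier (H Mod K) \<subseteq> ?h ` carrier G"
    proof
      fix C assume "C \<in> carrier (H Mod K)"
      then obtain y where y: "y \<in> carrier H" "C = K #>\<^bsub>H\<^esub> y"
        by (auto simp: carrier_FactGroup)
      obtain x where x: "x \<in> carrier G" "y \<otimes>\<^bsub>H\<^esub> inv\<^bsub>H\<^esub> f x \<in> K"
        using onto[OF y(1)] by blast
      have "y \<in> K #>\<^bsub>H\<^esub> f x"
        using x fc y by (metis K.rcos_module_rev K.is_group)
      then have "C = ?h x"
        using y x fc K.repr_independence[OF _ _ K.is_subgroup] by metis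
      then show "C \<in> ?h ` carrier G" using x by blast
    qed
  qed (auto simp: carrier_FactGroup fc)
  ultimately show ?thesis using h.FactGroup_iso by simp
qed

lemma group_coker: "group (coker I M)"
  unfolding coker_def by (rule normal.factorgroup_is_group) (rule normal_mat_apply_image)

lemma int_lattice_pow:
  "x \<in> carrier (int_lattice I) \<Longrightarrow> x [^]\<^bsub>int_lattice I\<^esub> (m::nat) = (\<lambda>i\<in>I. int m * x i)"
  by (induction m) (auto simp: fun_eq_iff algebra_simps)

lemma mat_apply_closed: "mat_apply I M x \<in> carrier (int_lattice I)"
  by (simp add: mat_apply_def)

text \<open>A trivial integer kernel forces a nonzero determinant, and A adj(A) = det(A) I then puts
  every multiple of the determinant into the image. The common multiplier \<open>m\<close> later
  annihilates all classes of vectors of sum zero.\<close>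

lemma nonsingular_imp_multiples_in_image:
  fixes M :: "'i \<Rightarrow> 'i \<Rightarrow> int"
  assumes "finite I"
    and inj: "\<And>x. x \<in> carrier (int_lattice I) \<Longrightarrow> mat_apply I M x = (\<lambda>i\<in>I. 0) \<Longrightarrow> x = (\<lambda>i\<in>I. 0)"
  obtains m :: nat where "m > 0"
    "\<And>x. x \<in> carrier (int_lattice I) \<Longrightarrow>
      \<exists>y\<in>carrier (int_lattice I). mat_apply I M y = (\<lambda>i\<in>I. int m * x i)"
proof -
  define N where "N = card I"
  \<comment> \<open>Determinants belong to matrices indexed by an initial segment, so
    \<open>I\<close> is enumerated by \<open>e\<close>, with inverse \<open>d\<close>.\<close>
  obtain e where e: "bij_betw e {..<N} I"
    using ex_bij_betw_nat_finite[OF assms(1)] by (auto simp: N_def atLeast0LessThan)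
  define d where "d = inv_into {..<N} e"
  have de: "d (e j) = j" if "j < N" for j
    using e that by (simp add: d_def bij_betw_inv_into_left)
  have ed: "e (d i) = i" "d i < N" if "i \<in> I" for i
    using e that bij_betw_inv_into_right[OF e that] bij_betwE[OF bij_betw_inv_into[OF e]]
    by (auto simp: d_def)
  have eI: "e j \<in> I" if "j < N" for j using e that by (auto simp: bij_betw_def)
  define A where "A = mat N N (\<lambda>(i, j). M (e i) (e j))"
  have A: "A \<in> carrier_mat N N" by (simp add: A_def)
  define g where "g v = (\<lambda>i\<in>I. v $ d i)" for v :: "int vec"
  have gA: "mat_apply I M (g v) = g (A *\<^sub>v v)" if v: "v \<in> carrier_vec N" for v
  proof (rule ext)
    fix i
    show "mat_apply I M (g v) i = g (A *\<^sub>v v) i"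
    proof (cases "i \<in> I")
      case True
      have "(\<Sum>j\<in>I. M i j * g v j) = (\<Sum>j<N. M i (e j) * g v (e j))"
        by (rule sum.reindex_bij_betw[OF e, symmetric])
      also have "\<dots> = (A *\<^sub>v v) $ d i"
        using v ed[OF True]
        by (auto simp: A_def scalar_prod_def g_def eI de atLeast0LessThan intro!: sum.cong)
      finally show ?thesis using True by (simp add: mat_apply_def g_def)
    qed (simp add: mat_apply_def g_def)
  qed
  have det: "det A \<noteq> 0"
  proof
    assume "det A = 0"
    then obtain v where v: "v \<in> carrier_vec N" "v \<noteq> 0\<^sub>v N" "A *\<^sub>v v = 0\<^sub>v N"
      using det_0_iff_vec_prod_zero[OF A] by auto
    have "g v = (\<lambda>i\<in>I. 0)"
      by (rule inj) (auto simp: gA v, auto simp: g_def fun_eq_iff ed)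
    then have "v $ j = 0" if "j < N" for j
      using that eI[OF that] de[OF that] by (metis g_def restrict_apply')
    then have "v = 0\<^sub>v N" using v(1) by (intro eq_vecI) auto
    with v(2) show False by simp
  qed
  show thesis
  proof (rule that[of "nat \<bar>det A\<bar>"])
    show "nat \<bar>det A\<bar> > 0" using det by simp
    fix x assume x: "x \<in> carrier (int_lattice I)"
    \<comment> \<open>The sign of the determinant goes into the vector, so that the multiplier
      becomes the natural number |det A|.\<close>
    define w where "w = adj_mat A *\<^sub>v vec N (\<lambda>j. sgn (det A) * x (e j))"
    have w: "w \<in> carrier_vec N"
      using adj_mat(1)[OF A] by (simp add: w_def)
    have "A *\<^sub>v w = (det A \<cdot>\<^sub>m 1\<^sub>m N) *\<^sub>v vec N (\<lambda>j. sgn (det A) * x (e j))"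
      unfolding w_def adj_mat(2)[OF A, symmetric]
      by (rule assoc_mult_mat_vec[symmetric]) (use A adj_mat(1)[OF A] in auto)
    also have "\<dots> = vec N (\<lambda>j. \<bar>det A\<bar> * x (e j))"
      by (intro eq_vecI) (simp_all add: abs_sgn row_smult)
    finally have "mat_apply I M (g w) = (\<lambda>i\<in>I. int (nat \<bar>det A\<bar>) * x i)"
      unfolding gA[OF w] by (simp add: g_def ed cong: restrict_cong)
    then show "\<exists>y\<in>carrier (int_lattice I). mat_apply I M y = (\<lambda>i\<in>I. int (nat \<bar>det A\<bar>) * x i)"
      by (intro bexI[of _ "g w"]) (auto simp: g_def)
  qed
qed

section \<open>Laplacians with one vertex deleted\<close>

lemma out_degree_eq_sum_adjacency:
  assumes "pair_graph H"
  shows "int (out_degree (with_proj H) u) = (\<Sum>v\<in>pverts H. adjacency H u v)"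
proof -
  interpret H: pair_graph H by fact
  have "out_arcs (with_proj H) u = Pair u ` {v \<in> pverts H. (u, v) \<in> parcs H}"
    by (auto simp: out_arcs_def dest: H.wellformed')
  then have "out_degree (with_proj H) u = card {v \<in> pverts H. (u, v) \<in> parcs H}"
    by (simp add: out_degree_def card_image inj_on_def)
  also have "int \<dots> = (\<Sum>v\<in>pverts H. adjacency H u v)"
    using H.pair_finite_verts by (simp add: adjacency_def sum.If_cases Int_def)
  finally show ?thesis .
qed

text \<open>In terms of differences along edges, constant vectors visibly lie in the kernel, and at
  a maximum of \<open>y\<close> all summands are nonnegative. Both facts are used below.\<close>

lemma laplacian_apply:
  assumes "pair_graph H" and "v \<in> pverts H"
  shows "(\<Sum>u\<in>pverts H. laplacian H v u * y u) = (\<Sum>u\<in>pverts H. adjacency H v u * (y v - y u))"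
proof -
  interpret H: pair_graph H by fact
  have "(\<Sum>u\<in>pverts H. laplacian H v u * y u) =
      (\<Sum>u\<in>pverts H. (if v = u then int (out_degree (with_proj H) v) * y v else 0))
      - (\<Sum>u\<in>pverts H. adjacency H v u * y u)"
    unfolding sum_subtractf[symmetric]
    by (intro sum.cong) (auto simp: laplacian_def left_diff_distrib)
  also have "\<dots> = (\<Sum>u\<in>pverts H. adjacency H v u) * y v - (\<Sum>u\<in>pverts H. adjacency H v u * y u)"
    using assms H.pair_finite_verts by (simp add: out_degree_eq_sum_adjacency)
  finally show ?thesis
    by (simp add: sum_distrib_right sum_subtractf right_diff_distrib)
qed

lemma laplacian_sym:
  assumes "pair_graph H"
  shows "laplacian H u v = laplacian H v u"
proof -
  interpret H: pair_graph H by fact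
  have "(u, v) \<in> parcs H \<longleftrightarrow> (v, u) \<in> parcs H"
    using H.arcs_symmetric by blast
  then show ?thesis by (auto simp: laplacian_def adjacency_def)
qed

text \<open>Maximum principle: at a maximiser other than \<open>r\<close> a vanishing sum of
  nonnegative differences makes every neighbour a maximiser too. As \<open>r\<close> is such a
  neighbour, the maximum is \<open>y r = 0\<close>.\<close>

lemma harmonic_nonpos:
  assumes H: "pair_graph H" and r: "r \<in> pverts H" "\<And>v. v \<in> pverts H - {r} \<Longrightarrow> (v, r) \<in> parcs H"
    and y: "y r = 0" "\<And>v. v \<in> pverts H - {r} \<Longrightarrow> (\<Sum>u\<in>pverts H. laplacian H v u * y u) = 0"
    and "w \<in> pverts H"
  shows "y w \<le> 0"
proof -
  interpret H: pair_graph H by fact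
  have fin: "finite (pverts H)" by (rule H.pair_finite_verts)
  have "Max (y ` pverts H) \<in> y ` pverts H"
    using fin r(1) by (intro Max_in) auto
  then obtain v where v: "v \<in> pverts H" "y v = Max (y ` pverts H)"
    by auto
  have max: "y u \<le> y v" if "u \<in> pverts H" for u
    using v(2) fin that by simp
  have "y v = 0"
  proof (cases "v = r")
    case False
    have "(\<Sum>u\<in>pverts H. adjacency H v u * (y v - y u)) = 0"
      using y(2)[of v] v(1) False laplacian_apply[OF H v(1)] by simp
    then have "adjacency H v r * (y v - y r) = 0"
      using fin r(1) max by (subst (asm) sum_nonneg_eq_0_iff) (auto simp: adjacency_def)
    then show ?thesis using r(2)[of v] v(1) False y(1) by (simp add: adjacency_def)
  qed (simp add: y(1))
  with max[OF assms(6)] show ?thesis by simp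
qed

text \<open>Sending \<open>x\<close> to the class of \<open>ext x\<close> has the image of the
  reduced Laplacian as kernel. Its image is the torsion: the reduced Laplacian is nonsingular, so a
  fixed multiple of each \<open>ext x\<close> lies in \<open>N\<close>; conversely \<open>N\<close>
  consists of vectors of sum zero, so torsion classes have representatives of sum zero.\<close>

lemma reduced_laplacian_iso_jacobian:
  assumes H: "pair_graph H" and r: "r \<in> pverts H" "\<And>v. v \<in> pverts H - {r} \<Longrightarrow> (v, r) \<in> parcs H"
  shows "coker (pverts H - {r}) (laplacian H) \<cong> jacobian H"
proof -
  interpret H: pair_graph H by fact
  define V where "V = pverts H"
  define I where "I = V - {r}"
  define L where "L = laplacian H"
  define N where "N = mat_apply V L ` carrier (int_lattice V)"
  \<comment> \<open>\<open>ext\<close> fills in the coordinate at \<open>r\<close> so that the sum vanishes: the classes of vectors of sum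
    zero turn out to be exactly the torsion of the cokernel.\<close>
  define ext where "ext x = (\<lambda>v\<in>V. if v = r then - (\<Sum>u\<in>I. x u) else x v)" for x :: "_ \<Rightarrow> int"
  define ext0 where "ext0 x = (\<lambda>v\<in>V. if v = r then 0 else x v)" for x :: "_ \<Rightarrow> int"
  have fin: "finite V" "finite I" using H.pair_finite_verts by (auto simp: V_def I_def)
  have V: "V = insert r I" "r \<notin> I" using r(1) by (auto simp: V_def I_def)
  interpret N: normal N "int_lattice V"
    unfolding N_def by (rule normal_mat_apply_image)
  have ext_closed: "ext x \<in> carrier (int_lattice V)" for x
    by (simp add: ext_def)
  have ext_inj: "x = x'"
    if "ext x = ext x'" "x \<in> carrier (int_lattice I)" "x' \<in> carrier (int_lattice I)" for x x'
  proof (rule PiE_ext)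
    show "x i = x' i" if "i \<in> I" for i
      using fun_cong[OF \<open>ext x = ext x'\<close>, of i] V that by (auto simp: ext_def split: if_splits)
  qed (use that in auto)
  \<comment> \<open>By symmetry the column sums are row sums, that is, values of the Laplacian at a
    constant vector.\<close>
  have sum_L: "(\<Sum>v\<in>V. mat_apply V L y v) = 0" for y
  proof -
    have "(\<Sum>v\<in>V. mat_apply V L y v) = (\<Sum>v\<in>V. \<Sum>u\<in>V. L v u * y u)"
      by (simp add: mat_apply_def)
    also have "\<dots> = (\<Sum>u\<in>V. (\<Sum>v\<in>V. L u v * 1) * y u)"
      by (subst sum.swap) (simp add: sum_distrib_right L_def laplacian_sym[OF H] cong: sum.cong)
    also have "\<dots> = 0"
      unfolding L_def V_def by (simp add: laplacian_apply[OF H] del: mult_1_right)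
    finally show ?thesis .
  qed
  \<comment> \<open>A vector of sum zero is determined by its coordinates off \<open>r\<close>, so
    equalities between such vectors need checking only there.\<close>
  have ext_eq: "z = ext z'" if "z \<in> carrier (int_lattice V)" "(\<Sum>v\<in>V. z v) = 0"
    "\<And>v. v \<in> I \<Longrightarrow> z' v = z v" for z z'
  proof (rule PiE_ext)
    have "(\<Sum>v\<in>V. z v) = z r + (\<Sum>v\<in>I. z v)"
      using V fin by simp
    then have "z r = - (\<Sum>v\<in>I. z' v)" using that(2,3) by simp
    then show "z v = ext z' v" if "v \<in> V" for v
      using that V \<open>\<And>v. v \<in> I \<Longrightarrow> z' v = z v\<close> by (auto simp: ext_def)
  qed (use that(1) ext_closed in auto)
  have L_ext0: "mat_apply V L (ext0 y) = ext (mat_apply I L y)" for y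
  proof (rule ext_eq[OF mat_apply_closed sum_L])
    show "mat_apply I L y v = mat_apply V L (ext0 y) v" if "v \<in> I" for v
      using that V fin by (auto simp: mat_apply_def ext0_def intro!: sum.cong)
  qed
  \<comment> \<open>Subtracting the constant \<open>y r\<close> does not change the image, so an
    argument of the Laplacian may be normalised to vanish at \<open>r\<close>.\<close>
  have L_const: "mat_apply V L y = mat_apply V L (ext0 (\<lambda>v\<in>I. y v - y r))" for y
  proof -
    have "(\<Sum>u\<in>V. L v u * y u) = (\<Sum>u\<in>V. L v u * ext0 (\<lambda>v\<in>I. y v - y r) u)" if "v \<in> V" for v
      using that V unfolding L_def V_def laplacian_apply[OF H that[unfolded V_def]]
      by (intro sum.cong) (auto simp: ext0_def V_def)
    then show ?thesis by (simp add: mat_apply_def cong: restrict_cong)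
  qed
  have ext_in_N: "ext x \<in> N \<longleftrightarrow> x \<in> mat_apply I L ` carrier (int_lattice I)"
    if x: "x \<in> carrier (int_lattice I)" for x
  proof
    assume "ext x \<in> N"
    then obtain y where "ext x = mat_apply V L y" by (auto simp: N_def)
    then have "ext x = ext (mat_apply I L (\<lambda>v\<in>I. y v - y r))"
      using L_const[of y] L_ext0 by simp
    then have "x = mat_apply I L (\<lambda>v\<in>I. y v - y r)"
      using x mat_apply_closed by (rule ext_inj)
    then show "x \<in> mat_apply I L ` carrier (int_lattice I)" by auto
  next
    assume "x \<in> mat_apply I L ` carrier (int_lattice I)"
    then obtain y where "x = mat_apply I L y" by auto
    then have "ext x = mat_apply V L (ext0 y)" by (simp add: L_ext0)
    then show "ext x \<in> N" by (auto simp: N_def ext0_def)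
  qed
  \<comment> \<open>A kernel vector of the reduced matrix, extended by 0 at \<open>r\<close>, is
    harmonic off \<open>r\<close>; the maximum principle for it and its negative makes it
    zero.\<close>
  obtain m :: nat where m: "m > 0" "\<And>x. x \<in> carrier (int_lattice I) \<Longrightarrow>
      \<exists>y\<in>carrier (int_lattice I). mat_apply I L y = (\<lambda>i\<in>I. int m * x i)"
  proof (rule nonsingular_imp_multiples_in_image[OF fin(2), of L])
    fix x assume x: "x \<in> carrier (int_lattice I)" "mat_apply I L x = (\<lambda>i\<in>I. 0)"
    have eq: "(\<Sum>u\<in>V. L v u * ext0 x u) = 0" if "v \<in> V - {r}" for v
      using fun_cong[OF L_ext0[of x], of v] that x(2)
      by (auto simp: mat_apply_def ext_def I_def)
    have "ext0 x v \<le> 0" if "v \<in> V" for v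
      by (rule harmonic_nonpos[OF H r]) (use eq that r in \<open>auto simp: V_def L_def ext0_def\<close>)
    moreover have "- ext0 x v \<le> 0" if "v \<in> V" for v
      by (rule harmonic_nonpos[OF H r, of "\<lambda>v. - ext0 x v"])
        (use eq that r in \<open>auto simp: V_def L_def ext0_def sum_negf\<close>)
    ultimately have ext0_0: "ext0 x v = 0" if "v \<in> V" for v
      using that by force
    have "x v = 0" if "v \<in> I" for v
      using ext0_0[of v] that V by (auto simp: ext0_def split: if_splits)
    then show "x = (\<lambda>i\<in>I. 0)" using x(1) by (intro PiE_ext[where k = I]) auto
  qed blast
  let ?C = "int_lattice V Mod N" and ?f = "\<lambda>x. N #>\<^bsub>int_lattice V\<^esub> ext x"
  have "ext \<in> hom (int_lattice I) (int_lattice V)"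
    by (rule homI) (use V in \<open>auto simp: ext_def fun_eq_iff sum.distrib\<close>)
  then have f: "?f \<in> hom (int_lattice I) ?C"
    using hom_compose[OF _ N.r_coset_hom_Mod] by (fastforce simp: comp_def)
  then interpret f: group_hom "int_lattice I" ?C ?f
    by (simp add: group_hom_def group_hom_axioms_def N.factorgroup_is_group)
  have pow: "?f x [^]\<^bsub>?C\<^esub> k = N #>\<^bsub>int_lattice V\<^esub> (\<lambda>v\<in>V. int k * ext x v)" for x and k :: nat
    using ext_closed by (simp add: N.FactGroup_pow int_lattice_pow)
  have coset_eq: "N #>\<^bsub>int_lattice V\<^esub> z = N \<longleftrightarrow> z \<in> N" if "z \<in> carrier (int_lattice V)" for z
    using N.rcos_const[OF N.is_group] N.coset_join1[OF _ that N.is_subgroup] by blast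
  have img: "?f ` carrier (int_lattice I) = {X \<in> carrier ?C. \<exists>k::nat. k > 0 \<and> X [^]\<^bsub>?C\<^esub> k = \<one>\<^bsub>?C\<^esub>}"
  proof (intro subset_antisym subsetI)
    fix X assume "X \<in> ?f ` carrier (int_lattice I)"
    then obtain x where x: "x \<in> carrier (int_lattice I)" "X = ?f x" by blast
    have "(\<lambda>v\<in>V. int m * ext x v) = ext (\<lambda>i\<in>I. int m * x i)"
      using V by (auto simp: ext_def fun_eq_iff sum_distrib_left)
    also have "\<dots> \<in> N"
      using m(2)[OF x(1)] by (subst ext_in_N) (auto intro: rev_image_eqI)
    finally have "X [^]\<^bsub>?C\<^esub> m = \<one>\<^bsub>?C\<^esub>"
      unfolding x(2) pow by (simp add: coset_eq)
    then show "X \<in> {X \<in> carrier ?C. \<exists>k::nat. k > 0 \<and> X [^]\<^bsub>?C\<^esub> k = \<one>\<^bsub>?C\<^esub>}"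
      using m(1) x f.hom_closed by blast
  next
    fix X assume "X \<in> {X \<in> carrier ?C. \<exists>k::nat. k > 0 \<and> X [^]\<^bsub>?C\<^esub> k = \<one>\<^bsub>?C\<^esub>}"
    then obtain z k where z: "z \<in> carrier (int_lattice V)" "X = N #>\<^bsub>int_lattice V\<^esub> z"
      and k: "k > (0::nat)" "X [^]\<^bsub>?C\<^esub> k = N"
      by (auto simp: carrier_FactGroup)
    have "(\<lambda>v\<in>V. int k * z v) \<in> N"
      using k(2) z by (simp add: N.FactGroup_pow int_lattice_pow coset_eq)
    then obtain y where y: "(\<lambda>v\<in>V. int k * z v) = mat_apply V L y"
      by (auto simp: N_def)
    \<comment> \<open>The multiple by \<open>k\<close> has sum zero because it is in the image, and
      since \<open>k > 0\<close> the same holds for \<open>z\<close> itself.\<close>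
    have "(\<Sum>v\<in>V. int k * z v) = 0"
      using sum_L[of y] by (simp add: y[symmetric])
    then have "(\<Sum>v\<in>V. z v) = 0" using k(1) by (simp add: sum_distrib_left[symmetric])
    with z(1) have "z = ext (restrict z I)" by (rule ext_eq) simp
    with z(2) show "X \<in> ?f ` carrier (int_lattice I)" by (auto intro!: image_eqI[of _ _ "restrict z I"])
  qed
  \<comment> \<open>The torsion subgroup differs from \<open>?C\<close> only in its carrier, so
    \<open>?f\<close> is also a homomorphism onto it.\<close>
  have T: "torsion_subgroup ?C = ?C\<lparr>carrier := ?f ` carrier (int_lattice I)\<rparr>"
    unfolding torsion_subgroup_def img ..
  have "group (torsion_subgroup ?C)"
    unfolding T using f.img_is_subgroup N.factorgroup_is_group by (rule subgroup.subgroup_is_group)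
  moreover have "?f \<in> hom (int_lattice I) (torsion_subgroup ?C)"
    using f unfolding T hom_def by auto
  ultimately interpret t: group_hom "int_lattice I" "torsion_subgroup ?C" ?f
    by (simp add: group_hom_def group_hom_axioms_def)
  have "kernel (int_lattice I) (torsion_subgroup ?C) ?f = mat_apply I L ` carrier (int_lattice I)"
    using ext_in_N coset_eq[OF ext_closed] mat_apply_closed[of I L]
    by (auto simp: kernel_def T simp del: carrier_product_group)
  moreover have "?f ` carrier (int_lattice I) = carrier (torsion_subgroup ?C)"
    by (simp add: T)
  ultimately have "coker I L \<cong> torsion_subgroup ?C"
    using t.FactGroup_iso by (simp add: coker_def)
  then show ?thesis
    by (simp add: jacobian_def coker_def N_def I_def L_def V_def)
qed

section \<open>Quotients of the ring of Laurent polynomials\<close>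

lemma laurent_sum_singles:
  fixes P :: laurent
  shows "P = (\<Sum>i\<in>Poly_Mapping.keys P. Poly_Mapping.single i (Poly_Mapping.lookup P i))"
  by (rule poly_mapping_eqI)
    (simp add: lookup_sum lookup_single when_def sum.delta in_keys_iff)

lemma laurent_induct [case_names add single]:
  fixes a :: laurent
  assumes add: "\<And>a b. Q a \<Longrightarrow> Q b \<Longrightarrow> Q (a + b)"
    and single: "\<And>i c. Q (Poly_Mapping.single i c)"
  shows "Q a"
proof -
  have "Q 0" using single[of 0 0] by simp
  then have "Q (\<Sum>i\<in>S. Poly_Mapping.single i (Poly_Mapping.lookup a i))" for S
    by (induction S rule: infinite_finite_induct) (auto intro: add single)
  then show ?thesis by (subst laurent_sum_singles)
qed

lemma lookup_times_keys:
  fixes P Q :: laurent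
  shows "Poly_Mapping.lookup (P * Q) i =
    (\<Sum>j\<in>Poly_Mapping.keys P. Poly_Mapping.lookup P j * Poly_Mapping.lookup Q (i - j))"
proof -
  have "P * Q = (\<Sum>j\<in>Poly_Mapping.keys P. Poly_Mapping.single j (Poly_Mapping.lookup P j) * Q)"
    by (subst (1) laurent_sum_singles) (simp add: sum_distrib_right)
  then show ?thesis
    by (simp add: lookup_sum lookup_single_times)
qed

lemma keys_between_exps:
  "i \<in> Poly_Mapping.keys P \<Longrightarrow> low_exp P \<le> i \<and> i \<le> high_exp P"
  by (simp add: low_exp_def high_exp_def)

lemma exps_in_keys:
  assumes "P \<noteq> 0"
  shows "low_exp P \<in> Poly_Mapping.keys P" "high_exp P \<in> Poly_Mapping.keys P"
  using assms by (auto simp: low_exp_def high_exp_def intro: Min_in Max_in)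

text \<open>The extreme coefficients of a product are the products of the extreme coefficients, so a
  nonzero multiple of \<open>P\<close> spans at least the width of \<open>P\<close>. This gives
  uniqueness of remainders both modulo \<open>P\<close> and modulo z^n - 1.\<close>

lemma laurent_multiple_eq_0:
  fixes P Q :: laurent
  assumes "P \<noteq> 0" and "P dvd Q" and Q: "Poly_Mapping.keys Q \<subseteq> {c..<c + (high_exp P - low_exp P)}"
  shows "Q = 0"
proof (rule ccontr)
  assume "Q \<noteq> 0"
  obtain R where R: "Q = P * R" using assms(2) ..
  with \<open>Q \<noteq> 0\<close> have "R \<noteq> 0" by auto
  note e = exps_in_keys[OF \<open>P \<noteq> 0\<close>] exps_in_keys[OF \<open>R \<noteq> 0\<close>]
  \<comment> \<open>The condition says that (i, k) is the only pair of exponents contributing to the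
    coefficient at \<open>i + k\<close>; this holds at both extreme ends.\<close>
  have lookup_eq: "Poly_Mapping.lookup Q (i + k) = Poly_Mapping.lookup P i * Poly_Mapping.lookup R k"
    if "i \<in> Poly_Mapping.keys P"
      and "\<And>j. j \<in> Poly_Mapping.keys P \<Longrightarrow> j \<noteq> i \<Longrightarrow> i + k - j \<notin> Poly_Mapping.keys R" for i k
  proof -
    have "Poly_Mapping.lookup Q (i + k) =
        (\<Sum>j\<in>Poly_Mapping.keys P. if j = i then Poly_Mapping.lookup P i * Poly_Mapping.lookup R k else 0)"
      unfolding R lookup_times_keys using that by (intro sum.cong) (auto simp: in_keys_iff)
    then show ?thesis using that(1) by simp
  qed
  have "Poly_Mapping.lookup Q (high_exp P + high_exp R) =
      Poly_Mapping.lookup P (high_exp P) * Poly_Mapping.lookup R (high_exp R)"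
    using e(2) by (rule lookup_eq) (use keys_between_exps[of _ P] keys_between_exps[of _ R] in force)
  then have "high_exp P + high_exp R \<in> Poly_Mapping.keys Q"
    using e by (simp add: in_keys_iff)
  moreover have "Poly_Mapping.lookup Q (low_exp P + low_exp R) =
      Poly_Mapping.lookup P (low_exp P) * Poly_Mapping.lookup R (low_exp R)"
    using e(1) by (rule lookup_eq) (use keys_between_exps[of _ P] keys_between_exps[of _ R] in force)
  then have "low_exp P + low_exp R \<in> Poly_Mapping.keys Q"
    using e by (simp add: in_keys_iff)
  moreover have "low_exp R \<le> high_exp R"
    using keys_between_exps[OF e(3)] by simp
  ultimately have "high_exp P + high_exp R \<in> {c..<c + (high_exp P - low_exp P)}"
      "low_exp P + low_exp R \<in> {c..<c + (high_exp P - low_exp P)}" "low_exp R \<le> high_exp R"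
    using subsetD[OF Q] by simp_all
  then show False by auto
qed

lemma zpow_times: "zpow i * Poly_Mapping.single j a = Poly_Mapping.single (i + j) a"
  by (simp add: mult_single)

lemma single_sum: "Poly_Mapping.single k (\<Sum>i\<in>S. f i) = (\<Sum>i\<in>S. Poly_Mapping.single k (f i))"
  by (induction S rule: infinite_finite_induct) (simp_all add: single_add)

text \<open>Treating z and its inverse as separate generators matches the way a span is shown to be
  closed under each of them in \<open>combination_onto\<close>.\<close>

lemma laurent_shift_induct [case_names add const shift unshift]:
  fixes a :: laurent
  assumes add: "\<And>a b. Q a \<Longrightarrow> Q b \<Longrightarrow> Q (a + b)"
    and const: "\<And>c. Q (Poly_Mapping.single 0 c)"
    and shift: "\<And>a. Q a \<Longrightarrow> Q (zpow 1 * a)"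
    and unshift: "\<And>a. Q a \<Longrightarrow> Q (zpow (- 1) * a)"
  shows "Q a"
proof (induction a rule: laurent_induct)
  case (single i c)
  show ?case
  proof (induction i rule: int_induct[where k = 0])
    case (step1 i)
    then show ?case using shift[OF step1(2)] by (simp add: zpow_times add.commute)
  next
    case (step2 i)
    then show ?case using unshift[OF step2(2)] by (simp add: zpow_times)
  qed (rule const)
qed (rule add)

text \<open>The ideal generated by \<open>P\<close> and z^n - 1, with the multiple of z^n - 1 kept
  explicit so that its cofactor \<open>b\<close> can be replaced modulo \<open>P\<close>.\<close>

definition laurent_ideal :: "nat \<Rightarrow> laurent \<Rightarrow> laurent set" where
  "laurent_ideal n P = {a. \<exists>b. P dvd a - (zpow (int n) - 1) * b}"

definition laurent_group :: "laurent monoid" where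
  "laurent_group = \<lparr>carrier = UNIV, monoid.mult = (+), one = 0\<rparr>"

lemma laurent_group_simps [simp]:
  "carrier laurent_group = UNIV" "monoid.mult laurent_group = (+)" "one laurent_group = 0"
  by (simp_all add: laurent_group_def)

lemma comm_group_laurent: "comm_group laurent_group"
proof (rule comm_groupI)
  show "\<exists>y\<in>carrier laurent_group. y \<otimes>\<^bsub>laurent_group\<^esub> x = \<one>\<^bsub>laurent_group\<^esub>" for x
    by (rule bexI[of _ "- x"]) auto
qed (auto simp: add_ac)

lemma inv_laurent_group [simp]: "inv\<^bsub>laurent_group\<^esub> x = - x"
  by (rule group.inv_equality[OF comm_group.axioms(2)[OF comm_group_laurent]]) auto

lemma laurent_idealI: "P dvd a - (zpow (int n) - 1) * b \<Longrightarrow> a \<in> laurent_ideal n P"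
  by (auto simp: laurent_ideal_def)

lemma laurent_ideal_add:
  assumes "a \<in> laurent_ideal n P" "b \<in> laurent_ideal n P"
  shows "a + b \<in> laurent_ideal n P"
proof -
  obtain c d where "P dvd a - (zpow (int n) - 1) * c" "P dvd b - (zpow (int n) - 1) * d"
    using assms by (auto simp: laurent_ideal_def)
  then have "P dvd (a - (zpow (int n) - 1) * c) + (b - (zpow (int n) - 1) * d)"
    by (rule dvd_add)
  also have "\<dots> = (a + b) - (zpow (int n) - 1) * (c + d)"
    by (simp add: algebra_simps)
  finally show ?thesis by (rule laurent_idealI)
qed

lemma laurent_ideal_mult:
  assumes "a \<in> laurent_ideal n P"
  shows "c * a \<in> laurent_ideal n P"
proof -
  obtain d where "P dvd a - (zpow (int n) - 1) * d"
    using assms by (auto simp: laurent_ideal_def)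
  then have "P dvd c * (a - (zpow (int n) - 1) * d)" by (rule dvd_mult)
  then have "P dvd c * a - (zpow (int n) - 1) * (c * d)" by (simp add: algebra_simps)
  then show ?thesis by (rule laurent_idealI)
qed

lemma dvd_imp_laurent_ideal:
  "P dvd a \<Longrightarrow> a \<in> laurent_ideal n P" "zpow (int n) - 1 dvd a \<Longrightarrow> a \<in> laurent_ideal n P"
proof -
  assume "zpow (int n) - 1 dvd a"
  then obtain b where "a = (zpow (int n) - 1) * b" ..
  then show "a \<in> laurent_ideal n P" by (intro laurent_idealI[of _ _ _ b]) simp
qed (simp add: laurent_idealI[of _ _ _ 0])

lemma normal_laurent_ideal: "laurent_ideal n P \<lhd> laurent_group"
proof (rule comm_group.subgroup_imp_normal[OF comm_group_laurent])
  show "subgroup (laurent_ideal n P) laurent_group"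
    using laurent_ideal_mult[of _ n P "-1"] dvd_imp_laurent_ideal(1)[of P 0]
    by unfold_locales (auto intro: laurent_ideal_add)
qed

text \<open>Common interface for the two cokernels to be compared, that of the reduced Laplacian and
  that of the companion power: each is identified with the same quotient.\<close>

lemma coker_iso_laurent_quotient:
  assumes hom: "\<And>x y. f (\<lambda>i\<in>I. x i + y i) = f x + f y"
    and ker: "\<And>x. x \<in> carrier (int_lattice I) \<Longrightarrow>
      f x \<in> laurent_ideal n P \<longleftrightarrow> x \<in> mat_apply I M ` carrier (int_lattice I)"
    and onto: "\<And>a. \<exists>x\<in>carrier (int_lattice I). a - f x \<in> laurent_ideal n P"
  shows "coker I M \<cong> laurent_group Mod laurent_ideal n P"
  unfolding coker_def
proof (rule Mod_iso_Mod[where f = f])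
  show "f \<in> hom (int_lattice I) laurent_group"
    by (rule homI) (simp_all add: hom)
  show "{x \<in> carrier (int_lattice I). f x \<in> laurent_ideal n P} = mat_apply I M ` carrier (int_lattice I)"
    using ker mat_apply_closed by blast
qed (use onto normal_laurent_ideal in auto)

section \<open>Companion matrices\<close>

locale bimonic_laurent =
  fixes P :: laurent
  assumes bimonic: "bimonic P"
begin

definition s :: nat where "s = nat (high_exp P - low_exp P)"

definition a :: "nat \<Rightarrow> int" where "a m = Poly_Mapping.lookup P (low_exp P + int m)"

text \<open>
  Multiplication by \<open>z\<close> sends \<open>horner j\<close> to \<open>horner (j - 1) - a j\<close> modulo \<open>P\<close>, which is exactly how
  the companion matrix acts on the \<open>j\<close>-th unit vector. (In the basis \<open>1, z, \<dots>, z\<^sup>s\<^sup>-\<^sup>1\<close> multiplication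
  by \<open>z\<close> would be its transpose.)
\<close>

definition horner :: "nat \<Rightarrow> laurent" where
  "horner j = (\<Sum>m\<in>{j<..s}. Poly_Mapping.single (int m - int j - 1) (a m))"

text \<open>Coordinates with respect to the Horner polynomials: \<open>combination_onto\<close> and
  \<open>combination_dvd_imp_0\<close> show that these form an integral basis modulo
  \<open>P\<close>.\<close>

definition combination :: "int vec \<Rightarrow> laurent" where
  "combination v = (\<Sum>j<s. Poly_Mapping.single 0 (v $ j) * horner j)"

abbreviation A :: "int mat" where "A \<equiv> companion P"

lemma s_pos: "0 < s" and int_s: "int s = high_exp P - low_exp P"
  using bimonic by (auto simp: s_def bimonic_def)

lemma a_0 [simp]: "a 0 = 1" and a_s [simp]: "a s = 1"
  using bimonic by (auto simp: a_def int_s bimonic_def)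

lemma nonzero: "P \<noteq> 0"
  using bimonic by (auto simp: bimonic_def)

lemma A_carrier [simp]: "A \<in> carrier_mat s s"
  by (simp add: companion_def s_def Let_def)

lemma A_mult_index:
  assumes "v \<in> carrier_vec s" "i < s"
  shows "(A *\<^sub>v v) $ i = (if i = s - 1 then - (\<Sum>j<s. a j * v $ j) else v $ Suc i)"
proof -
  have "(A *\<^sub>v v) $ i = (\<Sum>j<s. (if i = s - 1 then - a j else if j = Suc i then 1 else 0) * v $ j)"
    using assms by (auto simp: companion_def Let_def s_def[symmetric] a_def scalar_prod_def
        atLeast0LessThan intro!: sum.cong)
  then show ?thesis using assms(2)
    by (auto simp: sum_negf if_distrib[of "\<lambda>x. x * _"] cong: if_cong)
qed

lemma horner_last: "horner (s - 1) = 1"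
proof -
  have "{s - 1<..s} = {s}" using s_pos by auto
  then show ?thesis using s_pos by (simp add: horner_def)
qed

lemma horner_Suc:
  assumes "Suc j < s"
  shows "zpow 1 * horner (Suc j) = horner j - Poly_Mapping.single 0 (a (Suc j))"
proof -
  have "{j<..s} = insert (Suc j) {Suc j<..s}" using assms by auto
  then have "horner j = Poly_Mapping.single 0 (a (Suc j))
      + (\<Sum>m\<in>{Suc j<..s}. Poly_Mapping.single (int m - int j - 1) (a m))"
    by (simp add: horner_def)
  then show ?thesis
    by (simp add: horner_def sum_distrib_left zpow_times)
qed

text \<open>Shifted to start at exponent 0, \<open>P\<close> has constant term
  \<open>a 0 = 1\<close>, and what remains is z times \<open>horner 0\<close>. Hence z times
  \<open>horner 0\<close> is -1 modulo \<open>P\<close>.\<close>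

lemma horner_0: "zpow 1 * horner 0 = zpow (- low_exp P) * P - 1"
proof -
  have keys: "Poly_Mapping.keys P \<subseteq> (\<lambda>m. low_exp P + int m) ` {..s}"
  proof
    fix i assume "i \<in> Poly_Mapping.keys P"
    then have "i = low_exp P + int (nat (i - low_exp P))" "nat (i - low_exp P) \<le> s"
      using keys_between_exps[of i P] by (auto simp: s_def)
    then show "i \<in> (\<lambda>m. low_exp P + int m) ` {..s}" by blast
  qed
  have "P = (\<Sum>i\<in>(\<lambda>m. low_exp P + int m) ` {..s}. Poly_Mapping.single i (Poly_Mapping.lookup P i))"
    by (subst laurent_sum_singles, rule sum.mono_neutral_left) (use keys in \<open>auto simp: in_keys_iff\<close>)
  also have "\<dots> = (\<Sum>m\<le>s. Poly_Mapping.single (low_exp P + int m) (a m))"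
    by (subst sum.reindex) (auto simp: a_def inj_on_def)
  finally have "zpow (- low_exp P) * P =
      zpow (- low_exp P) * (\<Sum>m\<le>s. Poly_Mapping.single (low_exp P + int m) (a m))"
    by (rule arg_cong)
  also have "\<dots> = (\<Sum>m\<le>s. Poly_Mapping.single (int m) (a m))"
    by (simp add: sum_distrib_left zpow_times)
  also have "{..s} = insert 0 {0<..s}" by auto
  also have "(\<Sum>m\<in>\<dots>. Poly_Mapping.single (int m) (a m)) = 1 + zpow 1 * horner 0"
    by (simp add: horner_def sum_distrib_left zpow_times)
  finally show ?thesis by simp
qed

lemma lookup_horner:
  "Poly_Mapping.lookup (horner j) i =
    (if 0 \<le> i \<and> i + int j < int s then a (nat i + j + 1) else 0)"
proof (cases "0 \<le> i")
  case True
  have "Poly_Mapping.lookup (horner j) i = (\<Sum>m\<in>{j<..s}. if m = nat i + j + 1 then a m else 0)"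
    unfolding horner_def lookup_sum lookup_single
    using True by (intro sum.cong) (auto simp: when_def)
  then show ?thesis using True by (auto simp: nat_less_iff)
next
  case False
  then show ?thesis
    by (auto simp: horner_def lookup_sum lookup_single when_def intro!: sum.neutral)
qed

lemma combination_add:
  assumes "v \<in> carrier_vec s" "w \<in> carrier_vec s"
  shows "combination (v + w) = combination v + combination w"
  using assms by (simp add: combination_def single_add distrib_right sum.distrib)

lemma combination_diff:
  assumes "v \<in> carrier_vec s" "w \<in> carrier_vec s"
  shows "combination (v - w) = combination v - combination w"
  using assms by (simp add: combination_def single_diff left_diff_distrib sum_subtractf)

text \<open>Multiplication by z moves the coefficient of \<open>horner (Suc j)\<close> to
  \<open>horner j\<close>, and the subtracted constants collect to minus the sum of the
  \<open>a j * v $ j\<close>. As \<open>horner (s - 1) = 1\<close>, that sum is the last coordinate,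
  as in the last row of the companion matrix.\<close>

lemma combination_companion:
  assumes v: "v \<in> carrier_vec s"
  shows "P dvd zpow 1 * combination v - combination (A *\<^sub>v v)"
proof -
  let ?c = "Poly_Mapping.single (0 :: int)"
  obtain t where t: "s = Suc t" using s_pos by (cases s) auto
  have "zpow 1 * combination v = (\<Sum>j<s. ?c (v $ j) * (zpow 1 * horner j))"
    by (simp add: combination_def sum_distrib_left mult_ac)
  also have "\<dots> = ?c (v $ 0) * (zpow (- low_exp P) * P - 1)
      + (\<Sum>j<t. ?c (v $ Suc j) * (horner j - ?c (a (Suc j))))"
    using horner_Suc by (simp add: t sum.lessThan_Suc_shift horner_0 del: sum.lessThan_Suc)
  finally have 1: "zpow 1 * combination v = \<dots>" .
  have "combination (A *\<^sub>v v) = (\<Sum>j<t. ?c ((A *\<^sub>v v) $ j) * horner j) + ?c ((A *\<^sub>v v) $ t) * horner t"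
    by (simp add: combination_def t)
  also have "\<dots> = (\<Sum>j<t. ?c (v $ Suc j) * horner j) - ?c (\<Sum>j<s. a j * v $ j)"
    using horner_last by (simp add: A_mult_index[OF v] t single_uminus del: sum.lessThan_Suc)
  also have "?c (\<Sum>j<s. a j * v $ j) = ?c (v $ 0) + (\<Sum>j<t. ?c (v $ Suc j) * ?c (a (Suc j)))"
    by (simp add: t sum.lessThan_Suc_shift single_add single_sum mult_single mult.commute
        del: sum.lessThan_Suc)
  \<comment> \<open>Only the term of \<open>horner 0\<close> wraps around through \<open>P\<close>,
    which explains the cofactor.\<close>
  finally have "zpow 1 * combination v - combination (A *\<^sub>v v) = P * (?c (v $ 0) * zpow (- low_exp P))"
    unfolding 1 by (simp add: algebra_simps sum_subtractf)
  then show ?thesis by simp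
qed

lemma combination_companion_power:
  assumes "v \<in> carrier_vec s"
  shows "P dvd zpow (int n) * combination v - combination (A ^\<^sub>m n *\<^sub>v v)"
  using assms
proof (induction n arbitrary: v)
  case (Suc n)
  let ?w = "A *\<^sub>v v"
  have w: "?w \<in> carrier_vec s" using Suc.prems by (rule mult_mat_vec_carrier[OF A_carrier])
  have "A ^\<^sub>m Suc n *\<^sub>v v = A ^\<^sub>m n *\<^sub>v ?w"
    using Suc.prems by (simp add: assoc_mult_mat_vec[of _ s s _ s])
  moreover have "zpow (int (Suc n)) = zpow (int n) * zpow 1"
    by (simp add: zpow_times add.commute)
  \<comment> \<open>Telescoping: first one factor z is traded for \<open>A\<close>, then the
    induction hypothesis is applied to \<open>?w\<close>.\<close>
  ultimately have "zpow (int (Suc n)) * combination v - combination (A ^\<^sub>m Suc n *\<^sub>v v) =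
      zpow (int n) * (zpow 1 * combination v - combination ?w)
      + (zpow (int n) * combination ?w - combination (A ^\<^sub>m n *\<^sub>v ?w))"
    by (simp add: algebra_simps)
  then show ?case
    using combination_companion[OF Suc.prems] Suc.IH[OF w] by (simp add: dvd_add)
qed (simp add: carrier_matD[OF A_carrier])

text \<open>All rows but the last are shifts, and the last contains \<open>v $ 0\<close> with
  coefficient \<open>- a 0 = -1\<close>, so the system is solvable over the integers. This is where
  the lowest coefficient of \<open>P\<close> being 1 matters.\<close>

lemma companion_surj:
  assumes w: "w \<in> carrier_vec s"
  obtains v where "v \<in> carrier_vec s" "A *\<^sub>v v = w"
proof
  define v where "v = vec s (\<lambda>j. if j = 0 then - w $ (s - 1) - (\<Sum>j<s - 1. a (Suc j) * w $ j)
    else w $ (j - 1))"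
  show v: "v \<in> carrier_vec s" by (simp add: v_def)
  obtain t where t: "s = Suc t" using s_pos by (cases s) auto
  have "(\<Sum>j<s. a j * v $ j) = - w $ (s - 1)"
    by (simp add: t sum.lessThan_Suc_shift v_def del: sum.lessThan_Suc)
  then have "(A *\<^sub>v v) $ i = w $ i" if "i < s" for i
    unfolding A_mult_index[OF v that] using that by (auto simp: v_def)
  then show "A *\<^sub>v v = w"
    using w carrier_matD[OF A_carrier] by (intro eq_vecI) auto
qed

text \<open>The span contains the constants because \<open>horner (s - 1) = 1\<close>, and it is
  stable under z and its inverse because \<open>A\<close> maps onto the integer vectors.\<close>

lemma combination_onto:
  "\<exists>v\<in>carrier_vec s. P dvd b - combination v"
proof (induction b rule: laurent_shift_induct)
  case (add a b)
  then obtain v w where vw: "v \<in> carrier_vec s" "w \<in> carrier_vec s"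
    "P dvd a - combination v" "P dvd b - combination w" by blast
  have "(a + b) - combination (v + w) = (a - combination v) + (b - combination w)"
    using vw by (simp add: combination_add)
  with vw show ?case by (metis add_carrier_vec dvd_add)
next
  case (const c)
  obtain t where t: "s = Suc t" using s_pos by (cases s) auto
  have "combination (vec s (\<lambda>j. if j = s - 1 then c else 0)) = Poly_Mapping.single 0 c"
    using horner_last by (simp add: combination_def t)
  then show ?case
    by (intro bexI[of _ "vec s (\<lambda>j. if j = s - 1 then c else 0)"]) auto
next
  case (shift b)
  then obtain v where v: "v \<in> carrier_vec s" "P dvd b - combination v" by blast
  have "P dvd zpow 1 * (b - combination v) + (zpow 1 * combination v - combination (A *\<^sub>v v))"
    using v combination_companion[OF v(1)] by (intro dvd_add) auto
  also have "\<dots> = zpow 1 * b - combination (A *\<^sub>v v)"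
    by (simp add: algebra_simps)
  finally have "P dvd zpow 1 * b - combination (A *\<^sub>v v)" .
  then show ?case using v(1) by (intro bexI[of _ "A *\<^sub>v v"]) (auto intro: mult_mat_vec_carrier[OF A_carrier])
next
  case (unshift b)
  then obtain w where w: "w \<in> carrier_vec s" "P dvd b - combination w" by blast
  \<comment> \<open>With \<open>A v = w\<close>, multiplication by z takes
    \<open>combination v\<close> to \<open>combination w\<close> modulo \<open>P\<close>, so its
    inverse takes \<open>w\<close> back to \<open>v\<close>.\<close>
  obtain v where v: "v \<in> carrier_vec s" "A *\<^sub>v v = w"
    using companion_surj[OF w(1)] .
  have "zpow (- 1) * (zpow 1 * combination v) = combination v"
    by (simp add: mult.assoc[symmetric] zpow_times)
  then have "zpow (- 1) * ((b - combination w) - (zpow 1 * combination v - combination (A *\<^sub>v v)))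
      = zpow (- 1) * b - combination v"
    by (simp add: v right_diff_distrib)
  moreover have "P dvd zpow (- 1) * ((b - combination w) - (zpow 1 * combination v - combination (A *\<^sub>v v)))"
    by (rule dvd_mult[OF dvd_diff[OF w(2) combination_companion[OF v(1)]]])
  ultimately have "P dvd zpow (- 1) * b - combination v" by simp
  then show ?case using v(1) by blast
qed

text \<open>All exponents lie in 0..s-1, too narrow for a nonzero multiple of \<open>P\<close>, so
  the combination itself vanishes. The Horner polynomials have distinct degrees s-1-j and leading
  coefficient \<open>a s = 1\<close>, hence are independent.\<close>

lemma combination_dvd_imp_0:
  assumes v: "v \<in> carrier_vec s" and "P dvd combination v"
  shows "v = 0\<^sub>v s"
proof (rule ccontr)
  have lookup: "Poly_Mapping.lookup (combination v) i =
      (\<Sum>j<s. v $ j * (if 0 \<le> i \<and> i + int j < int s then a (nat i + j + 1) else 0))" for i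
    by (simp add: combination_def lookup_sum lookup_single_times lookup_horner)
  have "combination v = 0"
    using nonzero assms(2)
  proof (rule laurent_multiple_eq_0)
    show "Poly_Mapping.keys (combination v) \<subseteq> {0..<0 + (high_exp P - low_exp P)}"
    proof
      fix i assume "i \<in> Poly_Mapping.keys (combination v)"
      moreover have "Poly_Mapping.lookup (combination v) i = 0" if "i \<notin> {0..<int s}"
        unfolding lookup using that by (intro sum.neutral) auto
      ultimately show "i \<in> {0..<0 + (high_exp P - low_exp P)}"
        using int_s by (auto simp: in_keys_iff)
    qed
  qed
  assume "v \<noteq> 0\<^sub>v s"
  then have "\<exists>j. j < s \<and> v $ j \<noteq> 0" using v by (metis eq_vecI carrier_vecD index_zero_vec)
  then obtain j where j: "j < s" "v $ j \<noteq> 0" and min: "\<And>i. i < j \<Longrightarrow> \<not> (i < s \<and> v $ i \<noteq> 0)"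
    using exists_least_iff[of "\<lambda>j. j < s \<and> v $ j \<noteq> 0"] by blast
  have least: "v $ i = 0" if "i < j" for i
    using min[OF that] that j(1) by simp
  \<comment> \<open>At the degree of \<open>horner j\<close>, smaller indices drop out by minimality
    of \<open>j\<close> and larger ones because their degree is lower.\<close>
  have "Poly_Mapping.lookup (combination v) (int (s - 1 - j)) = (\<Sum>i<s. if i = j then v $ j else 0)"
    unfolding lookup
  proof (rule sum.cong)
    fix i assume "i \<in> {..<s}"
    consider "i < j" | "i = j" | "i > j" by linarith
    then show "v $ i * (if 0 \<le> int (s - 1 - j) \<and> int (s - 1 - j) + int i < int s
        then a (nat (int (s - 1 - j)) + i + 1) else 0) = (if i = j then v $ j else 0)"
    proof cases
      case 2
      have "nat (int (s - 1 - j)) + j + 1 = s" using j(1) by simp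
      then show ?thesis using 2 j(1) by simp
    qed (use j(1) least in auto)
  qed simp
  with \<open>combination v = 0\<close> j show False by simp
qed

text \<open>In Horner coordinates multiplication by z^n - 1 is \<open>M\<close>. An element of the
  ideal is thus congruent modulo \<open>P\<close> to the combination of a vector \<open>M w\<close>,
  and independence turns the congruence into equality of vectors.\<close>

lemma coker_companion_power_iso:
  "coker_mat (A ^\<^sub>m n - 1\<^sub>m s) \<cong> laurent_group Mod laurent_ideal n P"
proof -
  define M where "M = A ^\<^sub>m n - 1\<^sub>m s"
  have M: "M \<in> carrier_mat s s" unfolding M_def by (rule minus_carrier_mat) simp
  let ?lat = "carrier (int_lattice {..<s})"
  let ?T = "zpow (int n) - 1"
  have apply_M: "mat_apply {..<s} (\<lambda>i j. M $$ (i, j)) x = (\<lambda>i\<in>{..<s}. (M *\<^sub>v vec s x) $ i)" for x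
    using M by (auto simp: mat_apply_def fun_eq_iff restrict_def scalar_prod_def atLeast0LessThan
        intro!: sum.cong)
  have comb_M: "P dvd ?T * combination v - combination (M *\<^sub>v v)" if v: "v \<in> carrier_vec s" for v
  proof -
    have "M *\<^sub>v v = A ^\<^sub>m n *\<^sub>v v - v"
      using v by (simp add: M_def minus_mult_distrib_mat_vec[of _ s s])
    then have "combination (M *\<^sub>v v) = combination (A ^\<^sub>m n *\<^sub>v v) - combination v"
      using v by (simp add: combination_diff mult_mat_vec_carrier[of _ s s])
    then have "?T * combination v - combination (M *\<^sub>v v)
        = zpow (int n) * combination v - combination (A ^\<^sub>m n *\<^sub>v v)"
      by (simp add: algebra_simps)
    then show ?thesis using combination_companion_power[OF v] by simp
  qed
  have "coker {..<s} (\<lambda>i j. M $$ (i, j)) \<cong> laurent_group Mod laurent_ideal n P"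
  proof (rule coker_iso_laurent_quotient[where f = "\<lambda>x. combination (vec s x)"])
    show "combination (vec s (\<lambda>i\<in>{..<s}. x i + y i)) = combination (vec s x) + combination (vec s y)"
      for x y
      by (subst combination_add[symmetric]) (auto intro!: arg_cong[where f = combination])
    show "\<exists>x\<in>?lat. b - combination (vec s x) \<in> laurent_ideal n P" for b
    proof -
      obtain v where v: "v \<in> carrier_vec s" "P dvd b - combination v"
        using combination_onto by blast
      have "vec s (\<lambda>i\<in>{..<s}. v $ i) = v" using v(1) by auto
      then show ?thesis
        using v(2) by (intro bexI[of _ "\<lambda>i\<in>{..<s}. v $ i"]) (auto intro: dvd_imp_laurent_ideal)
    qed
    fix x assume x: "x \<in> ?lat"
    let ?img = "mat_apply {..<s} (\<lambda>i j. M $$ (i, j)) ` ?lat"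
    show "combination (vec s x) \<in> laurent_ideal n P \<longleftrightarrow> x \<in> ?img"
    proof
      assume "combination (vec s x) \<in> laurent_ideal n P"
      then obtain b where b: "P dvd combination (vec s x) - ?T * b"
        by (auto simp: laurent_ideal_def)
      obtain w where w: "w \<in> carrier_vec s" "P dvd b - combination w"
        using combination_onto by blast
      have w': "vec s (\<lambda>i\<in>{..<s}. w $ i) = w" using w(1) by auto
      have Mw: "M *\<^sub>v w \<in> carrier_vec s" using M w(1) by (rule mult_mat_vec_carrier)
      have "combination (vec s x - M *\<^sub>v w) = (combination (vec s x) - ?T * b)
          + (?T * (b - combination w) + (?T * combination w - combination (M *\<^sub>v w)))"
        using Mw by (simp add: combination_diff algebra_simps)
      also have "P dvd \<dots>"
        using b w(2) comb_M[OF w(1)] by (intro dvd_add) auto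
      finally have "vec s x - M *\<^sub>v w = 0\<^sub>v s"
        by (intro combination_dvd_imp_0) (use Mw in auto)
      then have "x i = (M *\<^sub>v w) $ i" if "i < s" for i
        using Mw that by (metis carrier_vecD eq_iff_diff_eq_0 index_minus_vec(1) index_vec index_zero_vec(1))
      then have "x = mat_apply {..<s} (\<lambda>i j. M $$ (i, j)) (\<lambda>i\<in>{..<s}. w $ i)"
        unfolding apply_M w' using x by (intro PiE_ext[where k = "{..<s}"]) auto
      then show "x \<in> ?img" by auto
    next
      assume "x \<in> ?img"
      then obtain y where "x = (\<lambda>i\<in>{..<s}. (M *\<^sub>v vec s y) $ i)"
        by (auto simp: apply_M)
      then have "vec s x = M *\<^sub>v vec s y" using M by auto
      moreover have "P dvd combination (M *\<^sub>v vec s y) - ?T * combination (vec s y)"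
        using comb_M[of "vec s y"] by (metis dvd_minus_iff minus_diff_eq vec_carrier)
      ultimately show "combination (vec s x) \<in> laurent_ideal n P"
        by (auto intro: laurent_idealI)
    qed
  qed
  then show ?thesis
    using M by (simp add: coker_mat_def M_def)
qed

end

section \<open>Circulant graphs\<close>

lemma dvd_single_diff_single:
  assumes "[i = j] (mod int n)"
  shows "zpow (int n) - 1 dvd Poly_Mapping.single i c - Poly_Mapping.single j (c :: int)"
proof -
  have step: "zpow (int n) - 1 dvd
    Poly_Mapping.single (i + int n) c - Poly_Mapping.single i (c :: int)" for i
  proof -
    have "Poly_Mapping.single (i + int n) c - Poly_Mapping.single i c =
        (zpow (int n) - 1) * Poly_Mapping.single i c"
      by (simp add: left_diff_distrib zpow_times add.commute)
    then show ?thesis by simp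
  qed
  obtain q where q: "i = j + int n * q"
    using assms by (metis cong_iff_lin cong_sym)
  \<comment> \<open>The quotient \<open>q\<close> may be negative, so the single step by n is
    iterated in both directions.\<close>
  have "zpow (int n) - 1 dvd Poly_Mapping.single (j + int n * q) c - Poly_Mapping.single j c"
  proof (induction q rule: int_induct[where k = 0])
    case (step1 q)
    have "j + int n * (q + 1) = j + int n * q + int n" by (simp add: algebra_simps)
    then show ?case using dvd_add[OF step[of "j + int n * q"] step1(2)] by (simp only:) simp
  next
    case (step2 q)
    have "j + int n * q = (j + int n * (q - 1)) + int n" by (simp add: algebra_simps)
    then show ?case using dvd_diff[OF step2(2) step[of "j + int n * (q - 1)"]] by (simp only:) simp
  qed simp
  then show ?thesis by (simp add: q)
qed

text \<open>The representative with exponents below n of a residue modulo z^n - 1;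
  \<open>laurent_of_onto\<close> and \<open>laurent_of_inj\<close> give existence and
  uniqueness.\<close>

definition laurent_of :: "nat \<Rightarrow> (nat \<Rightarrow> int) \<Rightarrow> laurent" where
  "laurent_of n x = (\<Sum>i<n. Poly_Mapping.single (int i) (x i))"

lemma laurent_of_add: "laurent_of n (\<lambda>i. x i + y i) = laurent_of n x + laurent_of n y"
  by (simp add: laurent_of_def single_add sum.distrib)

lemma laurent_of_diff: "laurent_of n (\<lambda>i. x i - y i) = laurent_of n x - laurent_of n y"
  by (simp add: laurent_of_def single_diff sum_subtractf)

lemma laurent_of_sum: "laurent_of n (\<lambda>i. \<Sum>d\<in>D. x d i) = (\<Sum>d\<in>D. laurent_of n (x d))"
  unfolding laurent_of_def single_sum by (rule sum.swap)

lemma laurent_of_scale: "laurent_of n (\<lambda>i. int c * x i) = of_nat c * laurent_of n x"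
proof -
  have "Poly_Mapping.single i (int c * b) = of_nat c * Poly_Mapping.single i b" for i :: int and b
    by (subst single_of_nat[symmetric]) (simp add: mult_single del: single_of_nat)
  then show ?thesis by (simp add: laurent_of_def sum_distrib_left)
qed

lemma laurent_of_cong: "(\<And>i. i < n \<Longrightarrow> x i = y i) \<Longrightarrow> laurent_of n x = laurent_of n y"
  by (simp add: laurent_of_def)

lemma laurent_of_onto:
  assumes "n > 0"
  shows "\<exists>x. zpow (int n) - 1 dvd a - laurent_of n x"
proof (induction a rule: laurent_induct)
  case (add a b)
  then obtain x y where "zpow (int n) - 1 dvd a - laurent_of n x" "zpow (int n) - 1 dvd b - laurent_of n y"
    by blast
  then have "zpow (int n) - 1 dvd (a - laurent_of n x) + (b - laurent_of n y)" by (rule dvd_add)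
  also have "\<dots> = (a + b) - laurent_of n (\<lambda>i. x i + y i)" by (simp add: laurent_of_add)
  finally show ?case by blast
next
  case (single i c)
  define j where "j = nat (i mod int n)"
  have j: "j < n" "int j = i mod int n"
    using assms by (auto simp: j_def nat_less_iff)
  have "laurent_of n (\<lambda>k. if k = j then c else 0) = (\<Sum>k<n. if k = j then Poly_Mapping.single (int j) c else 0)"
    unfolding laurent_of_def by (intro sum.cong) auto
  also have "\<dots> = Poly_Mapping.single (int j) c" using j(1) by simp
  finally show ?case
    using dvd_single_diff_single[of i "int j" n c] j(2)
    by (intro exI[of _ "\<lambda>k. if k = j then c else 0"]) (simp add: cong_def)
qed

text \<open>The difference has its exponents in a window of length n, the width of z^n - 1, so it
  can only be the zero multiple.\<close>

lemma laurent_of_inj: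
  assumes "zpow (int n) - 1 dvd laurent_of n x - laurent_of n y" and "i < n"
  shows "x i = y i"
proof -
  let ?T = "zpow (int n) - 1" and ?d = "\<lambda>i. x i - y i"
  have n: "n > 0" using assms(2) by simp
  have lookup_T: "Poly_Mapping.lookup ?T j = (if j = int n then 1 else 0) - (if j = 0 then 1 else 0)" for j
    by (simp add: lookup_minus lookup_single lookup_one when_def)
  have keys_T: "Poly_Mapping.keys ?T = {0, int n}"
    using n by (auto simp: in_keys_iff lookup_T split: if_splits)
  have lookup: "Poly_Mapping.lookup (laurent_of n ?d) j = (\<Sum>k<n. if j = int k then ?d k else 0)" for j
    by (auto simp: laurent_of_def lookup_sum lookup_single when_def intro!: sum.cong)
  have "laurent_of n ?d = 0"
  proof (rule laurent_multiple_eq_0)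
    show "?T \<noteq> 0" using keys_T by force
    show "?T dvd laurent_of n ?d" using assms(1) by (simp add: laurent_of_diff)
    show "Poly_Mapping.keys (laurent_of n ?d) \<subseteq> {0..<0 + (high_exp ?T - low_exp ?T)}"
    proof
      fix j assume "j \<in> Poly_Mapping.keys (laurent_of n ?d)"
      moreover have "Poly_Mapping.lookup (laurent_of n ?d) j = 0" if "\<And>k. k < n \<Longrightarrow> j \<noteq> int k"
        unfolding lookup using that by (intro sum.neutral) auto
      ultimately obtain k where "k < n" "j = int k"
        by (auto simp: in_keys_iff)
      then show "j \<in> {0..<0 + (high_exp ?T - low_exp ?T)}"
        unfolding high_exp_def low_exp_def keys_T by simp
    qed
  qed
  then have "(\<Sum>k<n. if int i = int k then ?d k else 0) = 0"
    using lookup[of "int i"] by simp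
  then show ?thesis using assms(2) by simp
qed

text \<open>The value read at \<open>i\<close> comes from position i + d, so exponents drop by d;
  hence the sign in \<open>zpow (- d)\<close>.\<close>

lemma laurent_of_rotate:
  assumes "n > 0"
  shows "zpow (int n) - 1 dvd
    laurent_of n (\<lambda>i. x (nat ((int i + d) mod int n))) - zpow (- d) * laurent_of n x"
proof -
  define p where "p i = nat ((int i + d) mod int n)" for i
  have p: "p i < n" "[int (p i) = int i + d] (mod int n)" for i
    using assms by (auto simp: p_def nat_less_iff cong_def)
  have "inj_on p {..<n}"
  proof (rule inj_onI)
    fix i j assume ij: "i \<in> {..<n}" "j \<in> {..<n}" "p i = p j"
    have "[int i + d = int j + d] (mod int n)"
      using p(2)[of i] p(2)[of j] ij(3) by (metis cong_sym cong_trans)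
    then have "[int i = int j] (mod int n)" by (simp add: cong_add_rcancel)
    then show "i = j" using ij by (simp add: cong_int_iff cong_less_modulus_unique_nat)
  qed
  then have "bij_betw p {..<n} {..<n}"
    using p(1) by (intro bij_betw_imageI endo_inj_surj) auto
  then have "(\<Sum>i<n. Poly_Mapping.single (int (p i) - d) (x (p i))) =
      (\<Sum>j<n. Poly_Mapping.single (int j - d) (x j))"
    by (rule sum.reindex_bij_betw)
  then have "zpow (- d) * laurent_of n x = (\<Sum>i<n. Poly_Mapping.single (int (p i) - d) (x (p i)))"
    by (simp add: laurent_of_def sum_distrib_left zpow_times)
  \<comment> \<open>The exponent \<open>int (p i) - d\<close> may leave the range 0..n-1, but it
    stays congruent to \<open>i\<close>.\<close>
  moreover have "zpow (int n) - 1 dvd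
      Poly_Mapping.single (int i) (x (p i)) - Poly_Mapping.single (int (p i) - d) (x (p i))" for i
    using cong_diff[OF p(2)[of i] cong_refl[of d]]
    by (intro dvd_single_diff_single) (simp add: cong_sym)
  ultimately show ?thesis
    by (auto simp: laurent_of_def p_def[symmetric] sum_subtractf[symmetric] intro!: dvd_sum)
qed

section \<open>The adjacency matrix of a circulant graph as multiplication by a Laurent
  polynomial\<close>

definition jumps :: "nat \<Rightarrow> (nat \<Rightarrow> nat) \<Rightarrow> int set" where
  "jumps k s = (\<lambda>r. int (s r)) ` {1..k} \<union> (\<lambda>r. - int (s r)) ` {1..k}"

text \<open>With c = 2k this would represent the Laplacian of the circulant graph itself; a free
  constant makes room for the additional edges of the cobordism and the cone.\<close>

definition circulant_symbol :: "nat \<Rightarrow> nat \<Rightarrow> (nat \<Rightarrow> nat) \<Rightarrow> laurent" where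
  "circulant_symbol c k s = of_nat c - (\<Sum>r=1..k. zpow (int (s r)) + zpow (- int (s r)))"

locale circulant =
  fixes n k :: nat and s :: "nat \<Rightarrow> nat"
  assumes s_inj: "inj_on s {1..k}"
    and s_bounds: "r \<in> {1..k} \<Longrightarrow> 1 \<le> s r \<and> 2 * s r < n"
begin

abbreviation "C \<equiv> circulant_graph n k s"

lemma pair_graph: "pair_graph C"
proof (rule pair_graph_circulant)
  show "1 \<le> s r \<and> s r < n" if "r \<in> {1..k}" for r
    using s_bounds[OF that] by linarith
qed

lemma sum_jumps: "(\<Sum>d\<in>jumps k s. f d) = (\<Sum>r=1..k. f (int (s r)) + f (- int (s r)))"
proof -
  let ?p = "\<lambda>r. int (s r)" and ?m = "\<lambda>r. - int (s r)"
  have inj: "inj_on ?p {1..k}" "inj_on ?m {1..k}"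
    using s_inj unfolding inj_on_def of_nat_eq_iff neg_equal_iff_equal by blast+
  have "?p ` {1..k} \<inter> ?m ` {1..k} = {}"
    using s_bounds by fastforce
  then have "(\<Sum>d\<in>jumps k s. f d) = (\<Sum>d\<in>?p ` {1..k}. f d) + (\<Sum>d\<in>?m ` {1..k}. f d)"
    unfolding jumps_def by (intro sum.union_disjoint) auto
  also have "(\<Sum>d\<in>?p ` {1..k}. f d) = (\<Sum>r=1..k. f (?p r))"
    by (rule sum.reindex_cong[OF inj(1)]) simp_all
  also have "(\<Sum>d\<in>?m ` {1..k}. f d) = (\<Sum>r=1..k. f (?m r))"
    by (rule sum.reindex_cong[OF inj(2)]) simp_all
  finally show ?thesis by (simp only: sum.distrib)
qed

text \<open>Offsets are below n/2 in absolute value, so two of them differ by less than n. Without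
  such uniqueness the 0/1 adjacency entries would not count the jumps one by one, as the Laurent
  polynomial does.\<close>

lemma jumps_cong_unique:
  assumes "d \<in> jumps k s" "e \<in> jumps k s" "[d = e] (mod int n)"
  shows "d = e"
proof (rule ccontr)
  assume "d \<noteq> e"
  moreover have "2 * \<bar>d\<bar> < int n" "2 * \<bar>e\<bar> < int n"
    using assms(1,2) s_bounds by (fastforce simp: jumps_def)+
  then have "\<bar>d - e\<bar> < int n" by linarith
  moreover have "int n dvd d - e" using assms(3) by (simp add: cong_iff_dvd_diff)
  ultimately show False using dvd_imp_le_int[of "d - e" "int n"] by simp
qed

lemma adjacency_eq_sum:
  assumes "i < n" "j < n"
  shows "adjacency C i j = (\<Sum>d\<in>jumps k s. if [int j = int i + d] (mod int n) then 1 else 0)"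
proof -
  have adj: "adjacency C i j = (if \<exists>d\<in>jumps k s. [int j = int i + d] (mod int n) then 1 else 0)"
    using assms by (simp add: adjacency_def circulant_graph_def jumps_def bex_Un bex_disj_distrib)
  show ?thesis
proof (cases "\<exists>d\<in>jumps k s. [int j = int i + d] (mod int n)")
  case True
  then obtain d where d: "d \<in> jumps k s" "[int j = int i + d] (mod int n)" by blast
  have "[int j = int i + e] (mod int n) \<longleftrightarrow> e = d" if "e \<in> jumps k s" for e
    using d jumps_cong_unique[OF that d(1)] by (metis cong_add_lcancel cong_sym cong_trans)
  then have "(\<Sum>e\<in>jumps k s. if [int j = int i + e] (mod int n) then 1 else 0) =
      (\<Sum>e\<in>jumps k s. if e = d then 1 else (0::int))"
    by (intro sum.cong) auto
  also have "\<dots> = 1" using d(1) by (simp add: jumps_def)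
  finally show ?thesis
    using True adj by simp
next
  case False
  then show ?thesis unfolding adj by (auto intro!: sum.neutral[symmetric])
  qed
qed

lemma adjacency_apply:
  assumes "i < n"
  shows "(\<Sum>j<n. adjacency C i j * x j) = (\<Sum>d\<in>jumps k s. x (nat ((int i + d) mod int n)))"
proof -
  have cong: "[int j = int i + d] (mod int n) \<longleftrightarrow> j = nat ((int i + d) mod int n)" if "j < n" for j d
    using that by (auto simp: cong_def)
  have "(\<Sum>j<n. adjacency C i j * x j) =
      (\<Sum>j<n. \<Sum>d\<in>jumps k s. if [int j = int i + d] (mod int n) then x j else 0)"
    using assms by (intro sum.cong) (auto simp: adjacency_eq_sum sum_distrib_right intro!: sum.cong)
  also have "\<dots> = (\<Sum>d\<in>jumps k s. \<Sum>j<n. if [int j = int i + d] (mod int n) then x j else 0)"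
    by (rule sum.swap)
  also have "\<dots> = (\<Sum>d\<in>jumps k s. \<Sum>j<n. if j = nat ((int i + d) mod int n) then x j else 0)"
    using cong by (intro sum.cong) auto
  also have "\<dots> = (\<Sum>d\<in>jumps k s. x (nat ((int i + d) mod int n)))"
    using assms by (simp add: nat_less_iff)
  finally show ?thesis .
qed

lemma sum_adjacency: "i < n \<Longrightarrow> (\<Sum>j<n. adjacency C i j) = 2 * int k"
  using adjacency_apply[of i "\<lambda>_. 1"] sum_jumps[of "\<lambda>_. 1 :: int"] by simp

text \<open>Each offset d acts as a rotation, that is, as multiplication by z^(-d) modulo z^n -
  1.\<close>

lemma laurent_of_adjacency:
  "zpow (int n) - 1 dvd
    laurent_of n (\<lambda>i. int c * x i - (\<Sum>j<n. adjacency C i j * x j)) - circulant_symbol c k s * laurent_of n x"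
proof (cases "n = 0")
  case False
  let ?y = "\<lambda>d i. x (nat ((int i + d) mod int n))"
  \<comment> \<open>The offsets come in pairs of opposite sign, so the sign of the exponent is
    immaterial.\<close>
  have symbol: "circulant_symbol c k s = of_nat c - (\<Sum>d\<in>jumps k s. zpow (- d))"
    unfolding circulant_symbol_def by (simp add: sum_jumps add.commute)
  have "laurent_of n (\<lambda>i. int c * x i - (\<Sum>j<n. adjacency C i j * x j)) =
      laurent_of n (\<lambda>i. int c * x i - (\<Sum>d\<in>jumps k s. ?y d i))"
    by (rule laurent_of_cong) (simp add: adjacency_apply)
  then have "laurent_of n (\<lambda>i. int c * x i - (\<Sum>j<n. adjacency C i j * x j)) - circulant_symbol c k s * laurent_of n x
      = - (\<Sum>d\<in>jumps k s. laurent_of n (?y d) - zpow (- d) * laurent_of n x)"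
    by (simp add: laurent_of_diff laurent_of_scale laurent_of_sum symbol left_diff_distrib sum_distrib_right sum_subtractf)
  then show ?thesis
    using laurent_of_rotate[of n x] False by (auto intro!: dvd_sum)
qed (simp add: laurent_of_def)

end

section \<open>The reduced Laplacian of the cone over a cobordism\<close>

lemma cone_cobordism_laplacian_apply:
  assumes G: "pair_graph G" "pverts G = W" and H: "pair_graph H" "pverts H = W" and w: "w \<in> W"
  defines "K \<equiv> cone (cobordism G H)" and "I \<equiv> pverts (cone (cobordism G H)) - {None}"
  shows "(\<Sum>u\<in>I. laplacian K (Some (Inl w)) u * x u) =
      2 * x (Some (Inl w)) + (\<Sum>v\<in>W. adjacency G w v * (x (Some (Inl w)) - x (Some (Inl v))))
      - x (Some (Inr w))" (is ?Inl)
    and "(\<Sum>u\<in>I. laplacian K (Some (Inr w)) u * x u) =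
      2 * x (Some (Inr w)) + (\<Sum>v\<in>W. adjacency H w v * (x (Some (Inr w)) - x (Some (Inr v))))
      - x (Some (Inl w))" (is ?Inr)
proof -
  interpret G: pair_graph G by fact
  have fin: "finite W" using G.pair_finite_verts G(2) by simp
  have K: "pair_graph K"
    unfolding K_def using G(1) H(1) by (intro pair_graph_cone pair_graph_cobordism)
  have I: "I = Some ` (W <+> W)" and V: "pverts K = insert None I"
    using G(2) H(2) by (auto simp: I_def K_def cone_def cobordism_def)
  have sum_I: "(\<Sum>u\<in>I. f u) = (\<Sum>v\<in>W. f (Some (Inl v))) + (\<Sum>v\<in>W. f (Some (Inr v)))"
    for f :: "_ \<Rightarrow> int"
    using fin by (simp add: I sum.reindex sum.Plus comp_def)
  have row: "(\<Sum>u\<in>I. laplacian K v u * x u) = x v + (\<Sum>u\<in>I. adjacency K v u * (x v - x u))"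
    if "v \<in> I" for v
  proof -
    \<comment> \<open>Extending by 0 at the apex turns a reduced row into a full Laplacian row; the
      edge to the apex then contributes \<open>x v\<close>.\<close>
    let ?y = "x(None := 0)"
    have "(\<Sum>u\<in>pverts K. laplacian K v u * ?y u) = (\<Sum>u\<in>pverts K. adjacency K v u * (?y v - ?y u))"
      using that by (intro laplacian_apply[OF K]) (simp add: V)
    moreover have "adjacency K v None = 1" "v \<noteq> None" "None \<notin> I" "finite I"
      using that fin G(2) H(2) by (auto simp: I K_def cone_def cobordism_def adjacency_def)
    moreover from this have "(\<Sum>u\<in>I. laplacian K v u * ?y u) = (\<Sum>u\<in>I. laplacian K v u * x u)"
      "(\<Sum>u\<in>I. adjacency K v u * (x v - ?y u)) = (\<Sum>u\<in>I. adjacency K v u * (x v - x u))"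
      by (auto intro!: sum.cong)
    ultimately show ?thesis by (simp add: V)
  qed
  have adj: "adjacency K (Some (Inl w)) (Some (Inl v)) = adjacency G w v"
    "adjacency K (Some (Inr w)) (Some (Inr v)) = adjacency H w v"
    "adjacency K (Some (Inl w)) (Some (Inr v)) = (if v = w then 1 else 0)"
    "adjacency K (Some (Inr w)) (Some (Inl v)) = (if v = w then 1 else 0)" for v
    using w G(2) H(2) by (auto simp: adjacency_def K_def cone_def cobordism_def)
  have delta: "(\<Sum>v\<in>W. (if v = w then 1 else 0) * f v) = f w" for f :: "_ \<Rightarrow> int"
    using w fin by (simp add: if_distrib[of "\<lambda>c. c * _"] cong: if_cong)
  have mem: "Some (Inl w) \<in> I" "Some (Inr w) \<in> I"
    using w by (auto simp: I)
  show ?Inl unfolding row[OF mem(1)] sum_I adj delta by simp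
  show ?Inr unfolding row[OF mem(2)] sum_I adj delta by simp
qed

text \<open>Modulo T the matrix sends (u, w) to (F1 u - w, F2 w - u). The map X1 + F1 X2 cancels u
  on such a pair and leaves (F1 F2 - 1) w = P w.\<close>

lemma reduced_cone_iso_laurent_quotient:
  assumes "circulant n k s1" and "circulant n l s2" and "n > 0"
  defines "K \<equiv> cone (cobordism (circulant_graph n k s1) (circulant_graph n l s2))"
  shows "coker (pverts K - {None}) (laplacian K) \<cong>
    laurent_group Mod laurent_ideal n
      (circulant_symbol (2 * k + 2) k s1 * circulant_symbol (2 * l + 2) l s2 - 1)"
proof -
  interpret C1: circulant n k s1 by fact
  interpret C2: circulant n l s2 by fact
  define I where "I = pverts K - {None}"
  define F1 where "F1 = circulant_symbol (2 * k + 2) k s1"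
  define F2 where "F2 = circulant_symbol (2 * l + 2) l s2"
  define P where "P = F1 * F2 - 1"
  define T where "T = zpow (int n) - 1"
  define L where "L = laplacian K"
  define X1 where "X1 x = laurent_of n (\<lambda>i. x (Some (Inl i)))" for x :: "(nat + nat) option \<Rightarrow> int"
  define X2 where "X2 x = laurent_of n (\<lambda>i. x (Some (Inr i)))" for x :: "(nat + nat) option \<Rightarrow> int"
  have verts: "pverts (circulant_graph n k s1) = {..<n}" "pverts (circulant_graph n l s2) = {..<n}"
    by (simp_all add: circulant_graph_def)
  have I: "I = Some ` ({..<n} <+> {..<n})"
    by (auto simp: I_def K_def cone_def cobordism_def circulant_graph_def)
  have mem: "Some (Inl i) \<in> I" "Some (Inr i) \<in> I" if "i < n" for i
    using that by (auto simp: I)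
  note rows = cone_cobordism_laplacian_apply[OF C1.pair_graph verts(1) C2.pair_graph verts(2),
      folded K_def, folded I_def L_def]
  \<comment> \<open>The diagonal 2k + 2 counts the 2k circulant neighbours, the copy of the vertex
    and the apex.\<close>
  have row1: "mat_apply I L x (Some (Inl i)) = int (2 * k + 2) * x (Some (Inl i))
      - (\<Sum>j<n. adjacency C1.C i j * x (Some (Inl j))) - x (Some (Inr i))" if "i < n" for x i
    using that rows(1)[of i x] C1.sum_adjacency[OF that]
    by (simp add: mat_apply_def mem right_diff_distrib sum_subtractf sum_distrib_right[symmetric]
        distrib_right)
  have row2: "mat_apply I L x (Some (Inr i)) = int (2 * l + 2) * x (Some (Inr i))
      - (\<Sum>j<n. adjacency C2.C i j * x (Some (Inr j))) - x (Some (Inl i))" if "i < n" for x i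
    using that rows(2)[of i x] C2.sum_adjacency[OF that]
    by (simp add: mat_apply_def mem right_diff_distrib sum_subtractf sum_distrib_right[symmetric]
        distrib_right)
  have X1_apply: "\<exists>q. X1 (mat_apply I L x) = F1 * X1 x - X2 x + T * q" for x
  proof -
    have "X1 (mat_apply I L x) = laurent_of n (\<lambda>i. int (2 * k + 2) * x (Some (Inl i))
        - (\<Sum>j<n. adjacency C1.C i j * x (Some (Inl j)))) - X2 x"
      unfolding X1_def X2_def laurent_of_diff[symmetric] by (rule laurent_of_cong) (rule row1)
    moreover obtain q where "laurent_of n (\<lambda>i. int (2 * k + 2) * x (Some (Inl i))
        - (\<Sum>j<n. adjacency C1.C i j * x (Some (Inl j)))) - F1 * X1 x = T * q"
      using C1.laurent_of_adjacency[of "2 * k + 2" "\<lambda>i. x (Some (Inl i))"]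
      unfolding F1_def T_def X1_def by (elim dvdE)
    ultimately show ?thesis by (intro exI[of _ q]) (simp add: algebra_simps)
  qed
  have X2_apply: "\<exists>q. X2 (mat_apply I L x) = F2 * X2 x - X1 x + T * q" for x
  proof -
    have "X2 (mat_apply I L x) = laurent_of n (\<lambda>i. int (2 * l + 2) * x (Some (Inr i))
        - (\<Sum>j<n. adjacency C2.C i j * x (Some (Inr j)))) - X1 x"
      unfolding X1_def X2_def laurent_of_diff[symmetric] by (rule laurent_of_cong) (rule row2)
    moreover obtain q where "laurent_of n (\<lambda>i. int (2 * l + 2) * x (Some (Inr i))
        - (\<Sum>j<n. adjacency C2.C i j * x (Some (Inr j)))) - F2 * X2 x = T * q"
      using C2.laurent_of_adjacency[of "2 * l + 2" "\<lambda>i. x (Some (Inr i))"]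
      unfolding F2_def T_def X2_def by (elim dvdE)
    ultimately show ?thesis by (intro exI[of _ q]) (simp add: algebra_simps)
  qed
  let ?lat = "carrier (int_lattice I)"
  have join: "\<exists>x\<in>?lat. X1 x = laurent_of n u \<and> X2 x = laurent_of n w" for u w
    by (intro bexI[of _ "\<lambda>v\<in>I. case the v of Inl i \<Rightarrow> u i | Inr i \<Rightarrow> w i"])
      (auto simp: X1_def X2_def I intro!: laurent_of_cong)
  have "coker I L \<cong> laurent_group Mod laurent_ideal n P"
  proof (rule coker_iso_laurent_quotient[where f = "\<lambda>x. X1 x + F1 * X2 x"])
    fix x y :: "(nat + nat) option \<Rightarrow> int"
    have "X1 (\<lambda>i\<in>I. x i + y i) = X1 x + X1 y" "X2 (\<lambda>i\<in>I. x i + y i) = X2 x + X2 y"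
      unfolding X1_def X2_def laurent_of_add[symmetric] by (auto simp: I intro!: laurent_of_cong)
    then show "X1 (\<lambda>i\<in>I. x i + y i) + F1 * X2 (\<lambda>i\<in>I. x i + y i)
        = (X1 x + F1 * X2 x) + (X1 y + F1 * X2 y)"
      by (simp add: algebra_simps)
  next
    fix b
    obtain u where u: "T dvd b - laurent_of n u"
      using laurent_of_onto[OF \<open>n > 0\<close>] unfolding T_def by blast
    \<comment> \<open>The first component alone already reaches every residue modulo T.\<close>
    obtain x where x: "x \<in> ?lat" "X1 x = laurent_of n u" "X2 x = laurent_of n (\<lambda>_. 0)"
      using join by blast
    have "laurent_of n (\<lambda>_. 0) = 0" by (simp add: laurent_of_def)
    then show "\<exists>x\<in>?lat. b - (X1 x + F1 * X2 x) \<in> laurent_ideal n P"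
      using u x by (intro bexI[of _ x]) (simp_all add: dvd_imp_laurent_ideal T_def)
  next
    fix x assume x: "x \<in> ?lat"
    show "X1 x + F1 * X2 x \<in> laurent_ideal n P \<longleftrightarrow> x \<in> mat_apply I L ` ?lat"
    proof
      assume "x \<in> mat_apply I L ` ?lat"
      then obtain y where y: "x = mat_apply I L y" by blast
      obtain q1 q2 where q: "X1 x = F1 * X1 y - X2 y + T * q1" "X2 x = F2 * X2 y - X1 y + T * q2"
        using X1_apply[of y] X2_apply[of y] unfolding y by blast
      have "(X1 x + F1 * X2 x) - T * (q1 + F1 * q2) = P * X2 y"
        unfolding q P_def by (simp add: algebra_simps)
      then have "P dvd (X1 x + F1 * X2 x) - T * (q1 + F1 * q2)" by simp
      then show "X1 x + F1 * X2 x \<in> laurent_ideal n P"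
        unfolding T_def by (rule laurent_idealI)
    next
      assume "X1 x + F1 * X2 x \<in> laurent_ideal n P"
      then obtain b c where bc: "(X1 x + F1 * X2 x) - T * b = P * c"
        by (auto simp: laurent_ideal_def T_def elim!: dvdE)
      \<comment> \<open>A preimage (u, w) of x is sought: w is the cofactor c of P, reduced modulo
        T, and u is then forced by the second component F2 w - u = X2.\<close>
      obtain w r where w: "c - laurent_of n w = T * r"
        using laurent_of_onto[OF \<open>n > 0\<close>, of c] by (auto simp: T_def elim!: dvdE)
      obtain u r' where u: "(F2 * laurent_of n w - X2 x) - laurent_of n u = T * r'"
        using laurent_of_onto[OF \<open>n > 0\<close>, of "F2 * laurent_of n w - X2 x"] by (auto simp: T_def elim!: dvdE)
      obtain y where y: "y \<in> ?lat" "X1 y = laurent_of n u" "X2 y = laurent_of n w"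
        using join by blast
      obtain q1 q2 where q: "X1 (mat_apply I L y) = F1 * X1 y - X2 y + T * q1"
        "X2 (mat_apply I L y) = F2 * X2 y - X1 y + T * q2"
        using X1_apply[of y] X2_apply[of y] by blast
      have W: "X2 y = c - T * r" and U: "X1 y = F2 * X2 y - X2 x - T * r'"
        and c: "X1 x = P * c + T * b - F1 * X2 x"
        using bc w u unfolding y by (simp_all add: algebra_simps)
      have "X1 (mat_apply I L y) - X1 x = T * (q1 - F1 * r' - P * r - b)"
        unfolding q(1) U c unfolding W P_def by (simp add: algebra_simps)
      moreover have "X2 (mat_apply I L y) - X2 x = T * (r' + q2)"
        unfolding q(2) U by (simp add: algebra_simps)
      ultimately have "T dvd X1 (mat_apply I L y) - X1 x" "T dvd X2 (mat_apply I L y) - X2 x"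
        by simp_all
      \<comment> \<open>Congruence modulo T becomes equality of coordinates, as representatives
        below n are unique.\<close>
      then have "mat_apply I L y (Some (Inl i)) = x (Some (Inl i))"
        "mat_apply I L y (Some (Inr i)) = x (Some (Inr i))" if "i < n" for i
        using that unfolding T_def X1_def X2_def by (auto dest: laurent_of_inj)
      then have "mat_apply I L y = x"
        using x mat_apply_closed[of I L y] by (intro PiE_ext[where k = I]) (auto simp: I)
      then show "x \<in> mat_apply I L ` ?lat" using y(1) by blast
    qed
  qed
  then show ?thesis by (simp add: I_def L_def P_def F1_def F2_def)
qed

theorem theorem5:
  fixes n k l :: nat and s1 s2 :: "nat \<Rightarrow> nat"
  assumes "k \<ge> 1" and "l \<ge> 1"
    and "1 \<le> s1 1" and "strict_mono_on {1..k} s1" and "real (s1 k) < real n / 2"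
    and "1 \<le> s2 1" and "strict_mono_on {1..l} s2" and "real (s2 l) < real n / 2"
  shows "let G = cobordism (circulant_graph n k s1) (circulant_graph n l s2);
             P = (of_nat (2 * k + 2) - (\<Sum>r=1..k. zpow (int (s1 r)) + zpow (- int (s1 r)))) *
                 (of_nat (2 * l + 2) - (\<Sum>r=1..l. zpow (int (s2 r)) + zpow (- int (s2 r)))) - 1;
             A = companion P
         in jacobian (cone G) \<cong> coker_mat (A ^\<^sub>m n - 1\<^sub>m (dim_row A))"
proof -
  have circ: "circulant n m s"
    if "m \<ge> 1" "1 \<le> s 1" "strict_mono_on {1..m} s" "real (s m) < real n / 2" for m s
  proof
    show "inj_on s {1..m}" using that(3) by (rule strict_mono_on_imp_inj_on)
    \<comment> \<open>Monotonicity carries the bounds on the first and last jump over to all of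
      them.\<close>
    show "1 \<le> s r \<and> 2 * s r < n" if "r \<in> {1..m}" for r
    proof -
      have "s 1 \<le> s r" "s r \<le> s m"
        using that \<open>m \<ge> 1\<close> strict_mono_on_leD[OF \<open>strict_mono_on {1..m} s\<close>] by auto
      then show ?thesis using \<open>1 \<le> s 1\<close> \<open>real (s m) < real n / 2\<close> by linarith
    qed
  qed
  have c1: "circulant n k s1" and c2: "circulant n l s2"
    using assms by (auto intro: circ)
  have n: "n > 0" using assms(5) by (cases n) auto
  define G where "G = cobordism (circulant_graph n k s1) (circulant_graph n l s2)"
  define P where "P = (of_nat (2 * k + 2) - (\<Sum>r=1..k. zpow (int (s1 r)) + zpow (- int (s1 r)))) *
                 (of_nat (2 * l + 2) - (\<Sum>r=1..l. zpow (int (s2 r)) + zpow (- int (s2 r)))) - 1"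
  have "pair_graph G"
    unfolding G_def using circulant.pair_graph[OF c1] circulant.pair_graph[OF c2]
    by (rule pair_graph_cobordism)
  \<comment> \<open>The apex \<open>None\<close> is adjacent to every other vertex, as the deleted
    vertex has to be.\<close>
  then have "coker (pverts (cone G) - {None}) (laplacian (cone G)) \<cong> jacobian (cone G)"
    by (intro reduced_laplacian_iso_jacobian pair_graph_cone) (auto simp: cone_def)
  then have "jacobian (cone G) \<cong> coker (pverts (cone G) - {None}) (laplacian (cone G))"
    by (rule group.iso_sym[OF group_coker])
  also have "\<dots> \<cong> laurent_group Mod laurent_ideal n P"
    using reduced_cone_iso_laurent_quotient[OF c1 c2 n]
    unfolding G_def P_def circulant_symbol_def .
  finally have 1: "jacobian (cone G) \<cong> laurent_group Mod laurent_ideal n P" .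
  \<comment> \<open>Both factors have extreme coefficients -1, so the extreme coefficients of their
    product are 1; the subtracted constant does not reach them.\<close>
  interpret bimonic_laurent P
    using bimonic_product_poly(1)[OF assms(4,1,3,7,2,6) P_def] by unfold_locales
  have "laurent_group Mod laurent_ideal n P \<cong> coker_mat (A ^\<^sub>m n - 1\<^sub>m s)"
    using coker_companion_power_iso
    by (rule group.iso_sym[rotated]) (simp add: coker_mat_def group_coker)
  with 1 have "jacobian (cone G) \<cong> coker_mat (A ^\<^sub>m n - 1\<^sub>m (dim_row A))"
    unfolding carrier_matD(1)[OF A_carrier] by (rule iso_trans)
  then show ?thesis
    unfolding G_def P_def Let_def .
qed

end
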